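(* Let $P(D)$ be a differential operator of order $m$ with coefficients in $\widetilde{\mathbb{C}}$. Then $P(D)$ is stronger than every differential operator with coefficients in $\widetilde{\mathbb{C}}$ of order $\le m$ if and only if $P(D)$ is $\mathcal{G}$-elliptic.
   Context: Nets are indexed by $\varepsilon\in(0,1]$. A net $(\lambda_\varepsilon)_\varepsilon$ of complex numbers is moderate if $|\lambda_\varepsilon|=O(\varepsilon^{-N})$ as $\varepsilon\to0$ for some $N\in\mathbb{N}$, negligible if $|\lambda_\varepsilon|=O(\varepsilon^q)$ for all $q\in\mathbb{N}$. $\widetilde{\mathbb{C}}$ is the ring of moderate nets modulo negligible nets. A differential operator of order $m$ with coefficients in $\widetilde{\mathbb{C}}$ is $P(D)=\sum_{|\alpha|\le m}c_\alpha D^\alpha$ on $\mathbb{R}^n$, $c_\alpha\in\widetilde{\mathbb{C}}$, $D=-i\partial$, with polynomial $P(\xi)=\sum_{|\alpha|\le m}c_\alpha\xi^\alpha$ and principal symbol $P_m(\xi)=\sum_{|\alpha|=m}c_\alpha\xi^\alpha$. A representative of $P$ (resp. $P_m$) is a net of polynomials $(P_\varepsilon)_\varepsilon$ (resp. $(P_{m,\varepsilon})_\varepsilon$) obtained by replacing each $c_\alpha$ by a representative $(c_{\alpha,\varepsilon})_\varepsilon$. For a polynomial $Q$, $\widetilde Q(\xi)=(\sum_\alpha|\partial^\alpha Q(\xi)|^2)^{1/2}$. $P(D)$ is stronger than $Q(D)$ (written $Q(D)\prec P(D)$) if there exist representatives $(P_\varepsilon)_\varepsilon$, $(Q_\varepsilon)_\varepsilon$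 and a moderate net $(\lambda_\varepsilon)_\varepsilon$ with $\widetilde{Q_\varepsilon}(\xi)\le\lambda_\varepsilon\widetilde{P_\varepsilon}(\xi)$ for all $\xi\in\mathbb{R}^n$ and $\varepsilon\in(0,1]$. $P(D)$ is $\mathcal{G}$-elliptic if there exist a representative $(P_{m,\varepsilon})_\varepsilon$ of $P_m$, a constant $c>0$ and $a\in\mathbb{R}$ such that $|P_{m,\varepsilon}(\xi)|\ge c\,\varepsilon^a|\xi|^m$ for all $\varepsilon\in(0,1]$ and $\xi\in\mathbb{R}^n$. *)

theory Defs
  imports "HOL-Analysis.Analysis" "HOL-Library.Landau_Symbols" "HOL-Library.Poly_Mapping"
begin

section \<open>The ring of generalized complex numbers\<close>

text \<open>
  A net indexed by \<open>(0,1]\<close> is a function on \<open>real\<close> whose values outside \<open>(0,1]\<close> are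
  irrelevant: the growth conditions only look at \<open>\<epsilon> \<rightarrow> 0+\<close>, and every pointwise condition
  below is restricted to \<open>{0<..1}\<close>.
\<close>

definition moderate :: "(real \<Rightarrow> 'a::real_normed_vector) \<Rightarrow> bool" where
  "moderate f \<longleftrightarrow> (\<exists>N::nat. (\<lambda>\<epsilon>. norm (f \<epsilon>)) \<in> O[at_right 0](\<lambda>\<epsilon>. inverse (\<epsilon> ^ N)))"

definition negligible_net :: "(real \<Rightarrow> 'a::real_normed_vector) \<Rightarrow> bool" where
  "negligible_net f \<longleftrightarrow> (\<forall>q::nat. (\<lambda>\<epsilon>. norm (f \<epsilon>)) \<in> O[at_right 0](\<lambda>\<epsilon>. \<epsilon> ^ q))"

lemma moderate_of_const [simp]: "moderate (\<lambda>_. c)"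
  unfolding moderate_def by (rule exI[of _ 0]) simp

lemma moderate_mono_exponent:
  assumes "(\<lambda>\<epsilon>. norm (f \<epsilon>)) \<in> O[at_right 0](\<lambda>\<epsilon>. inverse (\<epsilon> ^ N))" "N \<le> M"
  shows "(\<lambda>\<epsilon>. norm (f \<epsilon>)) \<in> O[at_right 0](\<lambda>\<epsilon>::real. inverse (\<epsilon> ^ M))"
proof -
  have "(\<lambda>\<epsilon>::real. inverse (\<epsilon> ^ N)) \<in> O[at_right 0](\<lambda>\<epsilon>. inverse (\<epsilon> ^ M))"
  proof (rule bigoI[where c = 1])
    show "\<forall>\<^sub>F \<epsilon> in at_right 0. norm (inverse (\<epsilon> ^ N)) \<le> 1 * norm (inverse (\<epsilon> ^ M) :: real)"
      using eventually_at_right_less[of "0::real"] eventually_at_right_real[of 0 "1::real", OF zero_less_one]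
    proof eventually_elim
      case (elim \<epsilon>)
      then have "\<epsilon> ^ M \<le> \<epsilon> ^ N" using assms(2) by (intro power_decreasing) auto
      then show ?case using elim by (simp add: le_imp_inverse_le norm_inverse norm_power)
    qed
  qed
  then show ?thesis using assms(1) by (rule landau_o.big_trans[rotated])
qed

lemma bigo_norm_add:
  assumes "(\<lambda>\<epsilon>. norm (f \<epsilon>)) \<in> O[F](h)" "(\<lambda>\<epsilon>. norm (g \<epsilon>)) \<in> O[F](h)"
  shows "(\<lambda>\<epsilon>. norm (f \<epsilon> + g \<epsilon>)) \<in> O[F](h :: real \<Rightarrow> real)"
proof -
  have "(\<lambda>\<epsilon>. norm (f \<epsilon> + g \<epsilon>)) \<in> O[F](\<lambda>\<epsilon>. norm (f \<epsilon>) + norm (g \<epsilon>))"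
    by (rule bigoI[where c = 1]) (simp add: norm_triangle_ineq)
  also have "(\<lambda>\<epsilon>. norm (f \<epsilon>) + norm (g \<epsilon>)) \<in> O[F](h)"
    using assms by (rule sum_in_bigo)
  finally show ?thesis .
qed

lemma moderate_add:
  assumes "moderate f" "moderate g"
  shows "moderate (\<lambda>\<epsilon>. f \<epsilon> + g \<epsilon>)"
proof -
  obtain N M where "(\<lambda>\<epsilon>. norm (f \<epsilon>)) \<in> O[at_right 0](\<lambda>\<epsilon>. inverse (\<epsilon> ^ N))"
    "(\<lambda>\<epsilon>. norm (g \<epsilon>)) \<in> O[at_right 0](\<lambda>\<epsilon>. inverse (\<epsilon> ^ M))"
    using assms unfolding moderate_def by blast
  then have "(\<lambda>\<epsilon>. norm (f \<epsilon>)) \<in> O[at_right 0](\<lambda>\<epsilon>. inverse (\<epsilon> ^ max N M))"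
    "(\<lambda>\<epsilon>. norm (g \<epsilon>)) \<in> O[at_right 0](\<lambda>\<epsilon>. inverse (\<epsilon> ^ max N M))"
    by (auto elim: moderate_mono_exponent)
  then show ?thesis unfolding moderate_def by (blast intro: bigo_norm_add)
qed

lemma moderate_mult:
  fixes f g :: "real \<Rightarrow> 'a::real_normed_field"
  assumes "moderate f" "moderate g"
  shows "moderate (\<lambda>\<epsilon>. f \<epsilon> * g \<epsilon>)"
proof -
  obtain N M where "(\<lambda>\<epsilon>. norm (f \<epsilon>)) \<in> O[at_right 0](\<lambda>\<epsilon>. inverse (\<epsilon> ^ N))"
    "(\<lambda>\<epsilon>. norm (g \<epsilon>)) \<in> O[at_right 0](\<lambda>\<epsilon>. inverse (\<epsilon> ^ M))"
    using assms unfolding moderate_def by blast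
  then have "(\<lambda>\<epsilon>. norm (f \<epsilon>) * norm (g \<epsilon>)) \<in>
      O[at_right 0](\<lambda>\<epsilon>. inverse (\<epsilon> ^ N) * inverse (\<epsilon> ^ M))"
    by (rule landau_o.big.mult)
  then have "(\<lambda>\<epsilon>. norm (f \<epsilon> * g \<epsilon>)) \<in> O[at_right 0](\<lambda>\<epsilon>. inverse (\<epsilon> ^ (N + M)))"
    by (simp add: norm_mult power_add)
  then show ?thesis unfolding moderate_def by blast
qed

lemma moderate_uminus: "moderate f \<Longrightarrow> moderate (\<lambda>\<epsilon>. - f \<epsilon>)"
  by (simp add: moderate_def)

lemma negligible_net_zero [simp]: "negligible_net (\<lambda>_. 0)"
  by (simp add: negligible_net_def)

lemma negligible_net_add:
  "negligible_net f \<Longrightarrow> negligible_net g \<Longrightarrow> negligible_net (\<lambda>\<epsilon>. f \<epsilon> + g \<epsilon>)"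
  unfolding negligible_net_def by (blast intro: bigo_norm_add)

lemma negligible_net_uminus: "negligible_net f \<Longrightarrow> negligible_net (\<lambda>\<epsilon>. - f \<epsilon>)"
  by (simp add: negligible_net_def)

lemma negligible_net_mult:
  fixes f g :: "real \<Rightarrow> 'a::real_normed_field"
  assumes "moderate f" "negligible_net g"
  shows "negligible_net (\<lambda>\<epsilon>. f \<epsilon> * g \<epsilon>)"
  unfolding negligible_net_def
proof
  fix q :: nat
  obtain N where N: "(\<lambda>\<epsilon>. norm (f \<epsilon>)) \<in> O[at_right 0](\<lambda>\<epsilon>. inverse (\<epsilon> ^ N))"
    using assms(1) unfolding moderate_def by blast
  have "(\<lambda>\<epsilon>. norm (g \<epsilon>)) \<in> O[at_right 0](\<lambda>\<epsilon>. \<epsilon> ^ (N + q))"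
    using assms(2) unfolding negligible_net_def by blast
  from landau_o.big.mult[OF N this]
  have "(\<lambda>\<epsilon>. norm (f \<epsilon> * g \<epsilon>)) \<in> O[at_right 0](\<lambda>\<epsilon>. inverse (\<epsilon> ^ N) * \<epsilon> ^ (N + q))"
    by (simp add: norm_mult)
  also have "(\<lambda>\<epsilon>::real. inverse (\<epsilon> ^ N) * \<epsilon> ^ (N + q)) \<in> \<Theta>[at_right 0](\<lambda>\<epsilon>. \<epsilon> ^ q)"
  proof (rule bigthetaI_cong)
    show "\<forall>\<^sub>F \<epsilon>::real in at_right 0. inverse (\<epsilon> ^ N) * \<epsilon> ^ (N + q) = \<epsilon> ^ q"
      using eventually_at_right_less[of "0::real"]
      by eventually_elim (simp add: power_add)
  qed
  finally show "(\<lambda>\<epsilon>. norm (f \<epsilon> * g \<epsilon>)) \<in> O[at_right 0](\<lambda>\<epsilon>. \<epsilon> ^ q)" .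
qed

lemma not_negligible_net_one: "\<not> negligible_net (\<lambda>_. 1 :: 'a::real_normed_field)"
proof
  assume "negligible_net (\<lambda>_. 1 :: 'a)"
  then have "(\<lambda>_. 1 :: real) \<in> O[at_right 0](\<lambda>\<epsilon>. \<epsilon> ^ 1)"
    unfolding negligible_net_def by (metis norm_one)
  then obtain C where C: "C > 0" "\<forall>\<^sub>F \<epsilon> in at_right 0. norm (1 :: real) \<le> C * norm (\<epsilon> ^ 1 :: real)"
    by (elim landau_o.bigE)
  have "\<forall>\<^sub>F \<epsilon> in at_right (0::real). \<epsilon> < 1 / C"
    using eventually_at_right_real[of 0 "1 / C"] C(1) by (auto elim: eventually_mono)
  then have "\<forall>\<^sub>F \<epsilon> in at_right (0::real). False"
    using C(2) eventually_at_right_less[of "0::real"]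
    by eventually_elim (use C(1) in \<open>auto simp: field_simps\<close>)
  then show False by simp
qed

definition net_equiv :: "(real \<Rightarrow> complex) \<Rightarrow> (real \<Rightarrow> complex) \<Rightarrow> bool" where
  "net_equiv f g \<longleftrightarrow> moderate f \<and> moderate g \<and> negligible_net (\<lambda>\<epsilon>. f \<epsilon> - g \<epsilon>)"

quotient_type gcomplex = "real \<Rightarrow> complex" / partial: net_equiv
proof (rule part_equivpI)
  show "\<exists>f. net_equiv f f"
    by (rule exI[of _ "\<lambda>_. 0"]) (simp add: net_equiv_def)
  show "symp net_equiv"
  proof (rule sympI)
    fix f g assume "net_equiv f g"
    then show "net_equiv g f"
      using negligible_net_uminus[of "\<lambda>\<epsilon>. f \<epsilon> - g \<epsilon>"] by (simp add: net_equiv_def)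
  qed
  show "transp net_equiv"
  proof (rule transpI)
    fix f g h assume "net_equiv f g" "net_equiv g h"
    then show "net_equiv f h"
      using negligible_net_add[of "\<lambda>\<epsilon>. f \<epsilon> - g \<epsilon>" "\<lambda>\<epsilon>. g \<epsilon> - h \<epsilon>"] by (simp add: net_equiv_def)
  qed
qed

instantiation gcomplex :: comm_ring_1
begin

lift_definition zero_gcomplex :: gcomplex is "\<lambda>_. 0"
  by (simp add: net_equiv_def)

lift_definition one_gcomplex :: gcomplex is "\<lambda>_. 1"
  by (simp add: net_equiv_def)

lift_definition plus_gcomplex :: "gcomplex \<Rightarrow> gcomplex \<Rightarrow> gcomplex" is "\<lambda>f g \<epsilon>. f \<epsilon> + g \<epsilon>"
  subgoal for f f' g g'
    using negligible_net_add[of "\<lambda>\<epsilon>. f \<epsilon> - f' \<epsilon>" "\<lambda>\<epsilon>. g \<epsilon> - g' \<epsilon>"]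
    by (simp add: net_equiv_def moderate_add add_diff_add)
  done

lift_definition uminus_gcomplex :: "gcomplex \<Rightarrow> gcomplex" is "\<lambda>f \<epsilon>. - f \<epsilon>"
  subgoal for f f'
    using negligible_net_uminus[of "\<lambda>\<epsilon>. f \<epsilon> - f' \<epsilon>"]
    by (simp add: net_equiv_def moderate_uminus)
  done

lift_definition minus_gcomplex :: "gcomplex \<Rightarrow> gcomplex \<Rightarrow> gcomplex" is "\<lambda>f g \<epsilon>. f \<epsilon> - g \<epsilon>"
  subgoal for f f' g g'
    using negligible_net_add[of "\<lambda>\<epsilon>. f \<epsilon> - f' \<epsilon>" "\<lambda>\<epsilon>. - (g \<epsilon> - g' \<epsilon>)"]
      negligible_net_uminus[of "\<lambda>\<epsilon>. g \<epsilon> - g' \<epsilon>"]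
      moderate_add[of f "\<lambda>\<epsilon>. - g \<epsilon>"] moderate_add[of f' "\<lambda>\<epsilon>. - g' \<epsilon>"]
    by (simp add: net_equiv_def moderate_uminus algebra_simps)
  done

lift_definition times_gcomplex :: "gcomplex \<Rightarrow> gcomplex \<Rightarrow> gcomplex" is "\<lambda>f g \<epsilon>. f \<epsilon> * g \<epsilon>"
  subgoal for f f' g g'
    using negligible_net_add[of "\<lambda>\<epsilon>. f \<epsilon> * (g \<epsilon> - g' \<epsilon>)" "\<lambda>\<epsilon>. g' \<epsilon> * (f \<epsilon> - f' \<epsilon>)"]
      negligible_net_mult[of f "\<lambda>\<epsilon>. g \<epsilon> - g' \<epsilon>"] negligible_net_mult[of g' "\<lambda>\<epsilon>. f \<epsilon> - f' \<epsilon>"]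
    by (simp add: net_equiv_def moderate_mult algebra_simps)
  done

instance
proof
  fix a b c :: gcomplex
  show "a + b + c = a + (b + c)"
    by transfer (simp add: net_equiv_def moderate_add)
  show "a + b = b + a"
    by transfer (simp add: net_equiv_def moderate_add)
  show "0 + a = a"
    by transfer (simp add: net_equiv_def)
  show "- a + a = 0"
    by transfer (simp add: net_equiv_def)
  show "a - b = a + - b"
    by transfer (simp add: net_equiv_def moderate_add[of _ "\<lambda>\<epsilon>. - _ \<epsilon>", simplified] moderate_uminus)
  show "a * b * c = a * (b * c)"
    by transfer (simp add: net_equiv_def moderate_mult mult.assoc)
  show "a * b = b * a"
    by transfer (simp add: net_equiv_def moderate_mult mult.commute)
  show "1 * a = a"
    by transfer (simp add: net_equiv_def)
  show "(a + b) * c = a * c + b * c"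
    by transfer (simp add: net_equiv_def moderate_mult moderate_add algebra_simps)
  show "(0::gcomplex) \<noteq> 1"
    using not_negligible_net_one[where 'a = complex] negligible_net_uminus[of "\<lambda>_. - 1 :: complex"]
    by transfer (auto simp: net_equiv_def)
qed

end

definition represents :: "(real \<Rightarrow> complex) \<Rightarrow> gcomplex \<Rightarrow> bool" where
  "represents f x \<longleftrightarrow> moderate f \<and> abs_gcomplex f = x"


section \<open>Polynomials in several variables\<close>

text \<open>
  A polynomial in the variables indexed by \<open>'n\<close> is its finitely supported family of coefficients;
  a differential operator with constant coefficients \<open>P(D) = \<Sum> c\<^sub>\<alpha> D\<^sup>\<alpha>\<close> is identified with its
  polynomial \<open>P(\<xi>) = \<Sum> c\<^sub>\<alpha> \<xi>\<^sup>\<alpha>\<close>.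
\<close>

type_synonym ('n, 'a) mpoly = "('n \<Rightarrow> nat) \<Rightarrow>\<^sub>0 'a"

definition mdeg :: "('n::finite \<Rightarrow> nat) \<Rightarrow> nat" where
  "mdeg \<alpha> = (\<Sum>i\<in>UNIV. \<alpha> i)"

text \<open>The order is an upper bound: the top-order coefficients are allowed to vanish.\<close>

definition has_order :: "nat \<Rightarrow> ('n::finite, 'a::zero) mpoly \<Rightarrow> bool" where
  "has_order m P \<longleftrightarrow> (\<forall>\<alpha>\<in>Poly_Mapping.keys P. mdeg \<alpha> \<le> m)"

lift_definition principal_part :: "nat \<Rightarrow> ('n::finite, 'a::zero) mpoly \<Rightarrow> ('n, 'a) mpoly"
  is "\<lambda>m c \<alpha>. if mdeg \<alpha> = m then c \<alpha> else 0"
  by (auto elim: rev_finite_subset)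

definition meval :: "('n::finite, complex) mpoly \<Rightarrow> real ^ 'n \<Rightarrow> complex" where
  "meval Q \<xi> = (\<Sum>\<alpha>\<in>Poly_Mapping.keys Q.
     Poly_Mapping.lookup Q \<alpha> * (\<Prod>i\<in>UNIV. complex_of_real (\<xi> $ i) ^ \<alpha> i))"

text \<open>
  \<open>mderiv \<alpha> Q\<close> is \<open>\<partial>\<^sup>\<alpha> Q\<close>, since \<open>\<partial>\<^sup>\<alpha> \<xi>\<^sup>\<alpha>\<^sup>+\<^sup>\<beta> = ((\<alpha> + \<beta>)! / \<beta>!) \<xi>\<^sup>\<beta>\<close>. Lemmas \<open>mderiv_zero\<close>,
  \<open>mderiv_Suc\<close> and \<open>meval_has_partial_derivative\<close> characterize it as the iterated partial
  derivative.
\<close>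

lift_definition mderiv :: "('n::finite \<Rightarrow> nat) \<Rightarrow> ('n, complex) mpoly \<Rightarrow> ('n, complex) mpoly"
  is "\<lambda>\<alpha> c \<beta>. (\<Prod>i\<in>UNIV. fact (\<alpha> i + \<beta> i) / fact (\<beta> i)) * c (\<lambda>i. \<alpha> i + \<beta> i)"
proof -
  fix \<alpha> :: "'n \<Rightarrow> nat" and c :: "('n \<Rightarrow> nat) \<Rightarrow> complex"
  assume fin: "finite {\<gamma>. c \<gamma> \<noteq> 0}"
  have "{\<beta>. (\<Prod>i\<in>UNIV. fact (\<alpha> i + \<beta> i) / fact (\<beta> i)) * c (\<lambda>i. \<alpha> i + \<beta> i) \<noteq> 0}
      \<subseteq> (\<lambda>\<gamma> i. \<gamma> i - \<alpha> i) ` {\<gamma>. c \<gamma> \<noteq> 0}"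
  proof
    fix \<beta> assume "\<beta> \<in> {\<beta>. (\<Prod>i\<in>UNIV. fact (\<alpha> i + \<beta> i) / fact (\<beta> i)) * c (\<lambda>i. \<alpha> i + \<beta> i) \<noteq> 0}"
    then have "(\<lambda>i. \<alpha> i + \<beta> i) \<in> {\<gamma>. c \<gamma> \<noteq> 0}" by auto
    then show "\<beta> \<in> (\<lambda>\<gamma> i. \<gamma> i - \<alpha> i) ` {\<gamma>. c \<gamma> \<noteq> 0}"
      by (rule rev_image_eqI) auto
  qed
  then show "finite {\<beta>. (\<Prod>i\<in>UNIV. fact (\<alpha> i + \<beta> i) / fact (\<beta> i)) * c (\<lambda>i. \<alpha> i + \<beta> i) \<noteq> 0}"
    using fin by (rule finite_subset[OF _ finite_imageI])
qed

lemma mderiv_zero: "mderiv (\<lambda>_. 0) Q = Q"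
  by transfer simp

lemma mderiv_add: "mderiv \<alpha> (mderiv \<beta> Q) = mderiv (\<lambda>i. \<alpha> i + \<beta> i) Q"
  by transfer (auto simp: fun_eq_iff prod.distrib[symmetric] mult.assoc[symmetric] add_ac
      intro!: prod.cong)

lemma mderiv_Suc: "mderiv (\<alpha>(j := Suc (\<alpha> j))) Q = mderiv ((\<lambda>_. 0)(j := 1)) (mderiv \<alpha> Q)"
proof -
  have "\<alpha>(j := Suc (\<alpha> j)) = (\<lambda>i. ((\<lambda>_. 0)(j := 1)) i + \<alpha> i)" by auto
  then show ?thesis by (simp add: mderiv_add)
qed

lemma meval_superset:
  assumes "finite A" "Poly_Mapping.keys Q \<subseteq> A"
  shows "meval Q \<xi> = (\<Sum>\<alpha>\<in>A. Poly_Mapping.lookup Q \<alpha> * (\<Prod>i\<in>UNIV. complex_of_real (\<xi> $ i) ^ \<alpha> i))"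
  unfolding meval_def
  by (rule sum.mono_neutral_left) (use assms in \<open>auto simp: in_keys_iff\<close>)

lemma meval_has_partial_derivative:
  fixes Q :: "('n::finite, complex) mpoly"
  shows "((\<lambda>t. meval Q (\<xi> + t *\<^sub>R axis j 1)) has_vector_derivative
           meval (mderiv ((\<lambda>_. 0)(j := 1)) Q) \<xi>) (at 0)"
proof -
  let ?e = "(\<lambda>_. 0)(j := 1) :: 'n \<Rightarrow> nat"
  let ?R = "\<lambda>\<alpha>. \<Prod>i\<in>UNIV - {j}. complex_of_real (\<xi> $ i) ^ \<alpha> i"
  let ?S = "\<lambda>\<beta> :: 'n \<Rightarrow> nat. \<beta>(j := Suc (\<beta> j))"
  let ?m = "\<lambda>\<alpha>. \<Prod>i\<in>UNIV. complex_of_real (\<xi> $ i) ^ \<alpha> i"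
  let ?K = "Poly_Mapping.keys Q"
  let ?B = "{\<beta>. ?S \<beta> \<in> ?K}"
  have split: "(\<Prod>i\<in>UNIV. complex_of_real ((\<xi> + t *\<^sub>R axis j 1) $ i) ^ \<alpha> i)
      = (complex_of_real (\<xi> $ j) + of_real t) ^ \<alpha> j * ?R \<alpha>" for t \<alpha>
  proof -
    have "(\<Prod>i\<in>UNIV - {j}. complex_of_real ((\<xi> + t *\<^sub>R axis j 1) $ i) ^ \<alpha> i) = ?R \<alpha>"
      by (rule prod.cong) (auto simp: axis_def)
    then show ?thesis
      by (subst prod.remove[of UNIV j]) (auto simp: axis_def)
  qed
  have inj: "inj ?S"
    by (rule injI) (metis fun_upd_same fun_upd_triv fun_upd_upd old.nat.inject)
  have finB: "finite ?B"
    using finite_vimageI[OF finite_keys inj] by (simp add: vimage_def)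
  have coeff: "Poly_Mapping.lookup (mderiv ?e Q) \<beta> =
      of_nat (Suc (\<beta> j)) * Poly_Mapping.lookup Q (?S \<beta>)" for \<beta>
  proof -
    have "(\<Prod>i\<in>UNIV. fact (?e i + \<beta> i) / fact (\<beta> i) :: complex) = of_nat (Suc (\<beta> j))"
      by (subst prod.remove[of UNIV j]) (auto intro!: prod.neutral)
    moreover have "(\<lambda>i. ?e i + \<beta> i) = ?S \<beta>" by auto
    ultimately show ?thesis by (simp add: mderiv.rep_eq)
  qed
  have D: "((\<lambda>t. \<Sum>\<alpha>\<in>?K. Poly_Mapping.lookup Q \<alpha> *
        ((complex_of_real (\<xi> $ j) + of_real t) ^ \<alpha> j * ?R \<alpha>)) has_vector_derivative
      (\<Sum>\<alpha>\<in>?K. Poly_Mapping.lookup Q \<alpha> *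
        ((of_nat (\<alpha> j) * complex_of_real (\<xi> $ j) ^ (\<alpha> j - 1)) * ?R \<alpha>))) (at 0)"
  proof (rule has_vector_derivative_sum)
    fix \<alpha>
    have "((\<lambda>z. Poly_Mapping.lookup Q \<alpha> * ((complex_of_real (\<xi> $ j) + z) ^ \<alpha> j * ?R \<alpha>))
        has_field_derivative Poly_Mapping.lookup Q \<alpha> *
        ((of_nat (\<alpha> j) * complex_of_real (\<xi> $ j) ^ (\<alpha> j - 1)) * ?R \<alpha>)) (at (of_real 0))"
      by (auto intro!: derivative_eq_intros)
    then show "((\<lambda>t. Poly_Mapping.lookup Q \<alpha> * ((complex_of_real (\<xi> $ j) + of_real t) ^ \<alpha> j * ?R \<alpha>))
        has_vector_derivative Poly_Mapping.lookup Q \<alpha> *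
        ((of_nat (\<alpha> j) * complex_of_real (\<xi> $ j) ^ (\<alpha> j - 1)) * ?R \<alpha>)) (at 0)"
      by (rule has_vector_derivative_real_field)
  qed
  have "(\<Sum>\<alpha>\<in>?K. Poly_Mapping.lookup Q \<alpha> *
        ((of_nat (\<alpha> j) * complex_of_real (\<xi> $ j) ^ (\<alpha> j - 1)) * ?R \<alpha>))
      = (\<Sum>\<alpha>\<in>?S ` ?B. Poly_Mapping.lookup Q \<alpha> *
        ((of_nat (\<alpha> j) * complex_of_real (\<xi> $ j) ^ (\<alpha> j - 1)) * ?R \<alpha>))"
  proof (rule sum.mono_neutral_right)
    show "\<forall>\<alpha>\<in>?K - ?S ` ?B. Poly_Mapping.lookup Q \<alpha> *
        ((of_nat (\<alpha> j) * complex_of_real (\<xi> $ j) ^ (\<alpha> j - 1)) * ?R \<alpha>) = 0"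
    proof
      fix \<alpha> assume *: "\<alpha> \<in> ?K - ?S ` ?B"
      have "\<alpha> j = 0"
      proof (rule ccontr)
        assume "\<alpha> j \<noteq> 0"
        then have "?S (\<alpha>(j := \<alpha> j - 1)) = \<alpha>" by auto
        then have "\<alpha> \<in> ?S ` ?B" using * by (intro rev_image_eqI[of "\<alpha>(j := \<alpha> j - 1)"]) auto
        then show False using * by blast
      qed
      then show "Poly_Mapping.lookup Q \<alpha> *
        ((of_nat (\<alpha> j) * complex_of_real (\<xi> $ j) ^ (\<alpha> j - 1)) * ?R \<alpha>) = 0" by simp
    qed
  qed auto
  also have "\<dots> = (\<Sum>\<beta>\<in>?B. Poly_Mapping.lookup (mderiv ?e Q) \<beta> * ?m \<beta>)"
  proof (rule sum.reindex_cong[of ?S])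
    show "inj_on ?S ?B" using inj by (rule inj_on_subset) simp
    fix \<beta> assume "\<beta> \<in> ?B"
    have "?R (?S \<beta>) = ?R \<beta>" by (rule prod.cong) auto
    moreover have "?m \<beta> = complex_of_real (\<xi> $ j) ^ \<beta> j * ?R \<beta>"
      by (subst prod.remove[of UNIV j]) auto
    ultimately show "Poly_Mapping.lookup Q (?S \<beta>) *
        ((of_nat (?S \<beta> j) * complex_of_real (\<xi> $ j) ^ (?S \<beta> j - 1)) * ?R (?S \<beta>))
      = Poly_Mapping.lookup (mderiv ?e Q) \<beta> * ?m \<beta>"
      by (simp only: coeff fun_upd_same diff_Suc_1 mult_ac)
  qed simp
  also have "\<dots> = meval (mderiv ?e Q) \<xi>"
    by (rule meval_superset[symmetric]) (use finB in \<open>auto simp: in_keys_iff coeff[simplified]\<close>)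
  finally show ?thesis
    using D by (simp only: meval_def[of Q] split)
qed

text \<open>
  Only finitely many \<open>\<partial>\<^sup>\<alpha> Q\<close> are nonzero, so \<open>Sum_any\<close> is the sum over all multi-indices.
\<close>

definition poly_tilde :: "('n::finite, complex) mpoly \<Rightarrow> real ^ 'n \<Rightarrow> real" where
  "poly_tilde Q \<xi> = sqrt (Sum_any (\<lambda>\<alpha>. (norm (meval (mderiv \<alpha> Q) \<xi>))\<^sup>2))"

lemma finite_poly_tilde_support:
  fixes Q :: "('n::finite, complex) mpoly"
  shows "finite {\<alpha>. (norm (meval (mderiv \<alpha> Q) \<xi>))\<^sup>2 \<noteq> 0}"
proof (rule finite_subset)
  show "finite (\<Union>\<gamma>\<in>Poly_Mapping.keys Q. {\<alpha>. \<forall>i. \<alpha> i \<le> \<gamma> i})"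
  proof (intro finite_UN_I finite_keys)
    fix \<gamma> :: "'n \<Rightarrow> nat"
    have "{\<alpha>. \<forall>i. \<alpha> i \<le> \<gamma> i} = PiE UNIV (\<lambda>i. {..\<gamma> i})" by (auto simp: PiE_def Pi_def)
    then show "finite {\<alpha>. \<forall>i. \<alpha> i \<le> \<gamma> i}" by (simp add: finite_PiE)
  qed
  show "{\<alpha>. (norm (meval (mderiv \<alpha> Q) \<xi>))\<^sup>2 \<noteq> 0} \<subseteq>
      (\<Union>\<gamma>\<in>Poly_Mapping.keys Q. {\<alpha>. \<forall>i. \<alpha> i \<le> \<gamma> i})"
  proof
    fix \<alpha> assume "\<alpha> \<in> {\<alpha>. (norm (meval (mderiv \<alpha> Q) \<xi>))\<^sup>2 \<noteq> 0}"
    then have "Poly_Mapping.keys (mderiv \<alpha> Q) \<noteq> {}" by (auto simp: meval_def)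
    then obtain \<beta> where "Poly_Mapping.lookup (mderiv \<alpha> Q) \<beta> \<noteq> 0"
      by (auto simp: in_keys_iff simp del: keys_eq_empty)
    then have "(\<lambda>i. \<alpha> i + \<beta> i) \<in> Poly_Mapping.keys Q"
      by (auto simp: mderiv.rep_eq in_keys_iff)
    then show "\<alpha> \<in> (\<Union>\<gamma>\<in>Poly_Mapping.keys Q. {\<alpha>. \<forall>i. \<alpha> i \<le> \<gamma> i})"
      by (rule UN_I) simp
  qed
qed


section \<open>Representatives, strength and ellipticity\<close>

text \<open>
  A representative replaces exactly the coefficients \<open>c\<^sub>\<alpha>\<close>, \<open>\<alpha> \<in> A\<close>, that occur in the defining sum,
  so that no negligible terms outside \<open>A\<close> are introduced: \<open>A = {\<alpha>. mdeg \<alpha> \<le> m}\<close> for an operator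
  of order \<open>m\<close>, and \<open>A = {\<alpha>. mdeg \<alpha> = m}\<close> for its principal symbol.
\<close>

definition poly_represents ::
    "('n \<Rightarrow> nat) set \<Rightarrow> (real \<Rightarrow> ('n::finite, complex) mpoly) \<Rightarrow> ('n, gcomplex) mpoly \<Rightarrow> bool" where
  "poly_represents A Pe P \<longleftrightarrow>
     (\<forall>\<epsilon>\<in>{0<..1}. Poly_Mapping.keys (Pe \<epsilon>) \<subseteq> A) \<and>
     (\<forall>\<alpha>\<in>A. represents (\<lambda>\<epsilon>. Poly_Mapping.lookup (Pe \<epsilon>) \<alpha>) (Poly_Mapping.lookup P \<alpha>))"

text \<open>\<open>stronger m P k Q\<close>: the operator \<open>P\<close> of order \<open>m\<close> is stronger than \<open>Q\<close> of order \<open>k\<close>.\<close>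

definition stronger ::
    "nat \<Rightarrow> ('n::finite, gcomplex) mpoly \<Rightarrow> nat \<Rightarrow> ('n, gcomplex) mpoly \<Rightarrow> bool" where
  "stronger m P k Q \<longleftrightarrow>
     (\<exists>Pe Qe. \<exists>l :: real \<Rightarrow> real.
        poly_represents {\<alpha>. mdeg \<alpha> \<le> m} Pe P \<and>
        poly_represents {\<alpha>. mdeg \<alpha> \<le> k} Qe Q \<and>
        moderate l \<and>
        (\<forall>\<epsilon>\<in>{0<..1}. \<forall>\<xi>. poly_tilde (Qe \<epsilon>) \<xi> \<le> l \<epsilon> * poly_tilde (Pe \<epsilon>) \<xi>))"

definition G_elliptic :: "nat \<Rightarrow> ('n::finite, gcomplex) mpoly \<Rightarrow> bool" where
  "G_elliptic m P \<longleftrightarrow>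
     (\<exists>Pme. poly_represents {\<alpha>. mdeg \<alpha> = m} Pme (principal_part m P) \<and>
        (\<exists>c>0. \<exists>a::real. \<forall>\<epsilon>\<in>{0<..1}. \<forall>\<xi>.
           norm (meval (Pme \<epsilon>) \<xi>) \<ge> c * \<epsilon> powr a * norm \<xi> ^ m))"

end

theory Submission
  imports Defs
begin

text \<open>
  If \<open>P\<close> is \<open>\<G>\<close>-elliptic, then \<open>poly_tilde P\<^sub>\<epsilon>\<close> is bounded below by a multiple of
  \<open>\<epsilon>\<^sup>N |\<xi>|\<^sup>m\<close> outside a ball of moderate radius, where the principal symbol dominates the lower
  order terms; inside that ball it is bounded below by the top-order derivatives, which are
  constants and cannot all be small. Both bounds are compared with the trivial upper bound of order
  \<open>(1 + |\<xi>|)\<^sup>m\<close> for \<open>poly_tilde Q\<^sub>\<epsilon>\<close>.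

  Conversely, strength over \<open>\<xi>\<^sub>j\<^sup>m\<close> passes to principal symbols by letting \<open>\<xi>\<close> tend to infinity
  along rays. The representatives obtained for the various \<open>j\<close> differ by negligible nets only, so
  for small \<open>\<epsilon>\<close> one fixed representative of the principal symbol dominates \<open>max\<^sub>j |\<xi>\<^sub>j|\<^sup>m\<close>; for the
  remaining \<open>\<epsilon>\<close> it is replaced by its value at a small parameter.
\<close>

section \<open>Nets\<close>

lemma moderate_iff_norm: "moderate (\<lambda>\<epsilon>. norm (f \<epsilon>)) \<longleftrightarrow> moderate f"
  by (simp add: moderate_def)

lemma moderate_sum:
  assumes "\<And>x. x \<in> A \<Longrightarrow> moderate (f x)"
  shows "moderate (\<lambda>\<epsilon>. \<Sum>x\<in>A. f x \<epsilon>)"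
  using assms by (induction A rule: infinite_finite_induct) (auto intro: moderate_add)

lemma moderate_power:
  fixes f :: "real \<Rightarrow> 'a::real_normed_field"
  assumes "moderate f"
  shows "moderate (\<lambda>\<epsilon>. f \<epsilon> ^ k)"
  by (induction k) (auto intro: moderate_mult assms)

lemma moderate_inverse_power: "moderate (\<lambda>\<epsilon>::real. inverse (\<epsilon> ^ N))"
  unfolding moderate_def by (rule exI[of _ N], rule bigoI[where c = 1]) simp

lemma moderate_cong:
  assumes "eventually (\<lambda>\<epsilon>. f \<epsilon> = g \<epsilon>) (at_right 0)"
  shows "moderate f \<longleftrightarrow> moderate g"
proof -
  have "eventually (\<lambda>\<epsilon>. norm (f \<epsilon>) = norm (g \<epsilon>)) (at_right 0)"
    using assms by eventually_elim simp
  from landau_o.big.in_cong[OF this] show ?thesis by (simp add: moderate_def)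
qed

lemma negligible_net_cong:
  assumes "eventually (\<lambda>\<epsilon>. f \<epsilon> = g \<epsilon>) (at_right 0)"
  shows "negligible_net f \<longleftrightarrow> negligible_net g"
proof -
  have "eventually (\<lambda>\<epsilon>. norm (f \<epsilon>) = norm (g \<epsilon>)) (at_right 0)"
    using assms by eventually_elim simp
  from landau_o.big.in_cong[OF this] show ?thesis by (simp add: negligible_net_def)
qed

lemma negligible_net_iff_norm: "negligible_net (\<lambda>\<epsilon>. norm (f \<epsilon>)) \<longleftrightarrow> negligible_net f"
  by (simp add: negligible_net_def)

lemma negligible_net_sum:
  assumes "\<And>x. x \<in> A \<Longrightarrow> negligible_net (f x)"
  shows "negligible_net (\<lambda>\<epsilon>. \<Sum>x\<in>A. f x \<epsilon>)"
  using assms by (induction A rule: infinite_finite_induct) (auto intro: negligible_net_add)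

lemma negligible_net_tendsto_0:
  assumes "negligible_net f"
  shows "(f \<longlongrightarrow> 0) (at_right 0)"
proof -
  have "(\<lambda>\<epsilon>. norm (f \<epsilon>)) \<in> O[at_right 0](\<lambda>\<epsilon>. \<epsilon> ^ 1)"
    using assms unfolding negligible_net_def by blast
  then obtain C where "eventually (\<lambda>\<epsilon>. norm (norm (f \<epsilon>)) \<le> C * norm (\<epsilon> ^ 1)) (at_right 0)"
    by (elim landau_o.bigE)
  then have "eventually (\<lambda>\<epsilon>. norm (f \<epsilon>) \<le> C * \<bar>\<epsilon>\<bar>) (at_right 0)" by simp
  moreover have "((\<lambda>\<epsilon>. C * \<bar>\<epsilon>\<bar>) \<longlongrightarrow> C * \<bar>0\<bar>) (at_right 0)"
    by (intro tendsto_intros)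
  ultimately show ?thesis
    using Lim_null_comparison[of f "\<lambda>\<epsilon>. C * \<bar>\<epsilon>\<bar>" "at_right 0"] by simp
qed

section \<open>Representatives of elements of the quotient ring\<close>

lemma represents_iff:
  assumes "represents f x"
  shows "represents g x \<longleftrightarrow> moderate g \<and> negligible_net (\<lambda>\<epsilon>. f \<epsilon> - g \<epsilon>)"
proof -
  have "moderate f" and x: "abs_gcomplex f = x" using assms by (auto simp: represents_def)
  \<comment> \<open>The quotient is partial: equal images under \<open>abs_gcomplex\<close> give
    \<open>net_equiv\<close> only for nets in its domain, the moderate ones. Hence moderateness of
    \<open>g\<close> stays a separate condition.\<close>
  moreover have "net_equiv f g \<longleftrightarrow> net_equiv f f \<and> net_equiv g g \<and> abs_gcomplex f = abs_gcomplex g"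
    using Quotient3_rel[OF Quotient3_gcomplex, of f g] by blast
  ultimately show ?thesis by (auto simp: represents_def net_equiv_def)
qed

text \<open>The class of a net only depends on its germ at \<open>0+\<close>, so a representative
  may be changed freely at parameters bounded away from zero.\<close>

lemma represents_cong:
  assumes "represents f x" "eventually (\<lambda>\<epsilon>. f \<epsilon> = g \<epsilon>) (at_right 0)"
  shows "represents g x"
proof -
  have "eventually (\<lambda>\<epsilon>. f \<epsilon> - g \<epsilon> = 0) (at_right 0)"
    using assms(2) by eventually_elim simp
  then show ?thesis
    using represents_iff[OF assms(1), of g] moderate_cong[OF assms(2)] assms(1)
      negligible_net_cong[of "\<lambda>\<epsilon>. f \<epsilon> - g \<epsilon>" "\<lambda>_. 0"]
    by (simp add: represents_def)
qed

lemma represents_exists: "\<exists>f. represents f x"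
proof -
  have "net_equiv (rep_gcomplex x) (rep_gcomplex x)" "abs_gcomplex (rep_gcomplex x) = x"
    by (rule Quotient3_rep_reflp[OF Quotient3_gcomplex], rule Quotient3_abs_rep[OF Quotient3_gcomplex])
  then show ?thesis unfolding represents_def net_equiv_def by blast
qed

text \<open>This supplies constant representatives for the coefficients of a single monomial,
  against which other representatives are measured.\<close>

lemma represents_of_bool: "represents (\<lambda>_. of_bool b) (of_bool b)"
  by (auto simp: represents_def zero_gcomplex_def one_gcomplex_def)


section \<open>Multi-indices and polynomial bounds\<close>

lemma finite_mdeg_le: "finite {\<alpha> :: 'n::finite \<Rightarrow> nat. mdeg \<alpha> \<le> m}"
proof (rule finite_subset)
  show "{\<alpha> :: 'n \<Rightarrow> nat. mdeg \<alpha> \<le> m} \<subseteq> PiE UNIV (\<lambda>_. {..m})"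
    by (auto simp: mdeg_def intro: order_trans[OF member_le_sum[of _ UNIV]])
  show "finite (PiE (UNIV :: 'n set) (\<lambda>_. {..m}))" by (simp add: finite_PiE)
qed

lemma finite_mdeg_eq: "finite {\<alpha> :: 'n::finite \<Rightarrow> nat. mdeg \<alpha> = m}"
  by (rule finite_subset[OF _ finite_mdeg_le[of m]]) auto

lemma mdeg_add: "mdeg (\<lambda>i. \<alpha> i + \<beta> i) = mdeg \<alpha> + mdeg \<beta>"
  by (simp add: mdeg_def sum.distrib)

lemma mdeg_eq_0_iff: "mdeg \<alpha> = 0 \<longleftrightarrow> \<alpha> = (\<lambda>_. 0)"
  by (auto simp: mdeg_def)

definition monomial :: "('n::finite \<Rightarrow> nat) \<Rightarrow> real ^ 'n \<Rightarrow> complex" where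
  "monomial \<alpha> \<xi> = (\<Prod>i\<in>UNIV. complex_of_real (\<xi> $ i) ^ \<alpha> i)"

lemma norm_monomial_le: "norm (monomial \<alpha> \<xi>) \<le> norm \<xi> ^ mdeg \<alpha>"
proof -
  have "norm (monomial \<alpha> \<xi>) = (\<Prod>i\<in>UNIV. \<bar>\<xi> $ i\<bar> ^ \<alpha> i)"
    by (simp add: monomial_def prod_norm[symmetric] norm_power)
  also have "\<dots> \<le> (\<Prod>i\<in>UNIV. norm \<xi> ^ \<alpha> i)"
    by (intro prod_mono conjI power_mono component_le_norm_cart) auto
  also have "\<dots> = norm \<xi> ^ mdeg \<alpha>" by (simp add: mdeg_def power_sum)
  finally show ?thesis .
qed

lemma monomial_scaleR: "monomial \<alpha> (t *\<^sub>R \<xi>) = of_real t ^ mdeg \<alpha> * monomial \<alpha> \<xi>"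
  by (simp add: monomial_def mdeg_def power_mult_distrib prod.distrib power_sum)

lemma monomial_axis: "monomial ((\<lambda>_. 0)(j := m)) \<xi> = of_real (\<xi> $ j) ^ m"
  unfolding monomial_def by (subst prod.remove[of UNIV j]) auto

lemma meval_eq_sum:
  assumes "finite A" "Poly_Mapping.keys Q \<subseteq> A"
  shows "meval Q \<xi> = (\<Sum>\<alpha>\<in>A. Poly_Mapping.lookup Q \<alpha> * monomial \<alpha> \<xi>)"
  using meval_superset[OF assms] by (simp add: monomial_def)

text \<open>The sum runs over a fixed finite index set and not over the keys, so along a net of
  polynomials with moderate coefficients it is a finite sum of moderate nets.\<close>

definition coeff_norm :: "nat \<Rightarrow> ('n::finite, complex) mpoly \<Rightarrow> real" where
  "coeff_norm m Q = (\<Sum>\<alpha> | mdeg \<alpha> \<le> m. norm (Poly_Mapping.lookup Q \<alpha>))"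

lemma coeff_norm_nonneg: "coeff_norm m Q \<ge> 0"
  by (simp add: coeff_norm_def sum_nonneg)

text \<open>Since \<open>1 + norm \<xi>\<close> is at least 1, the exponent of every monomial can be
  raised to \<open>m\<close>.\<close>

lemma norm_meval_le:
  assumes "Poly_Mapping.keys Q \<subseteq> {\<alpha>. mdeg \<alpha> \<le> m}"
  shows "norm (meval Q \<xi>) \<le> coeff_norm m Q * (1 + norm \<xi>) ^ m"
proof -
  have "norm (meval Q \<xi>) \<le> (\<Sum>\<alpha> | mdeg \<alpha> \<le> m. norm (Poly_Mapping.lookup Q \<alpha> * monomial \<alpha> \<xi>))"
    unfolding meval_eq_sum[OF finite_mdeg_le assms] by (rule norm_sum)
  also have "\<dots> \<le> (\<Sum>\<alpha> | mdeg \<alpha> \<le> m. norm (Poly_Mapping.lookup Q \<alpha>) * (1 + norm \<xi>) ^ m)"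
  proof (rule sum_mono)
    fix \<alpha> :: "'a \<Rightarrow> nat" assume "\<alpha> \<in> {\<alpha>. mdeg \<alpha> \<le> m}"
    then have "(1 + norm \<xi>) ^ mdeg \<alpha> \<le> (1 + norm \<xi>) ^ m" by (intro power_increasing) auto
    moreover have "norm \<xi> ^ mdeg \<alpha> \<le> (1 + norm \<xi>) ^ mdeg \<alpha>" by (intro power_mono) auto
    ultimately have "norm (monomial \<alpha> \<xi>) \<le> (1 + norm \<xi>) ^ m"
      using norm_monomial_le[of \<alpha> \<xi>] by linarith
    then show "norm (Poly_Mapping.lookup Q \<alpha> * monomial \<alpha> \<xi>)
        \<le> norm (Poly_Mapping.lookup Q \<alpha>) * (1 + norm \<xi>) ^ m"
      by (simp add: norm_mult mult_left_mono)
  qed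
  finally show ?thesis by (simp add: coeff_norm_def sum_distrib_right)
qed

text \<open>Multiplying by the radius \<open>r\<close> instead of lowering the exponent avoids the truncated
  \<open>m - 1\<close> when \<open>m = 0\<close>.\<close>

lemma norm_meval_lower_order_le:
  assumes "Poly_Mapping.keys Q \<subseteq> {\<alpha>. mdeg \<alpha> < m}" "norm \<xi> \<le> r" "1 \<le> r"
  shows "r * norm (meval Q \<xi>) \<le> coeff_norm m Q * r ^ m"
proof -
  have keys: "Poly_Mapping.keys Q \<subseteq> {\<alpha>. mdeg \<alpha> \<le> m}" using assms(1) by auto
  have "norm (meval Q \<xi>) \<le> (\<Sum>\<alpha> | mdeg \<alpha> \<le> m. norm (Poly_Mapping.lookup Q \<alpha> * monomial \<alpha> \<xi>))"
    unfolding meval_eq_sum[OF finite_mdeg_le keys] by (rule norm_sum)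
  then have "r * norm (meval Q \<xi>)
      \<le> r * (\<Sum>\<alpha> | mdeg \<alpha> \<le> m. norm (Poly_Mapping.lookup Q \<alpha> * monomial \<alpha> \<xi>))"
    using assms(3) by (intro mult_left_mono) auto
  also have "\<dots> = (\<Sum>\<alpha> | mdeg \<alpha> \<le> m. norm (Poly_Mapping.lookup Q \<alpha>) * (r * norm (monomial \<alpha> \<xi>)))"
    by (simp add: sum_distrib_left norm_mult mult_ac)
  also have "\<dots> \<le> (\<Sum>\<alpha> | mdeg \<alpha> \<le> m. norm (Poly_Mapping.lookup Q \<alpha>) * r ^ m)"
  proof (rule sum_mono)
    fix \<alpha> :: "'a \<Rightarrow> nat"
    show "norm (Poly_Mapping.lookup Q \<alpha>) * (r * norm (monomial \<alpha> \<xi>))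
        \<le> norm (Poly_Mapping.lookup Q \<alpha>) * r ^ m"
    proof (cases "\<alpha> \<in> Poly_Mapping.keys Q")
      case True
      have "norm (monomial \<alpha> \<xi>) \<le> r ^ mdeg \<alpha>"
        using norm_monomial_le[of \<alpha> \<xi>] power_mono[OF assms(2), of "mdeg \<alpha>"] by simp
      then have "r * norm (monomial \<alpha> \<xi>) \<le> r ^ Suc (mdeg \<alpha>)"
        using assms(3) by (simp add: mult_left_mono)
      \<comment> \<open>A key has degree strictly below \<open>m\<close>, so the additional factor
        \<open>r\<close> still leaves an exponent of at most \<open>m\<close>.\<close>
      also have "\<dots> \<le> r ^ m"
        using True assms by (intro power_increasing) auto
      finally show ?thesis by (intro mult_left_mono) auto
    next
      case False
      then show ?thesis by (simp add: in_keys_iff)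
    qed
  qed
  finally show ?thesis by (simp add: coeff_norm_def sum_distrib_right)
qed

text \<open>The coefficients are an arbitrary function, so that differences of two representatives
  can be inserted directly.\<close>

lemma norm_homogeneous_sum_le:
  "norm (\<Sum>\<alpha> | mdeg \<alpha> = m. a \<alpha> * monomial \<alpha> \<xi>) \<le> (\<Sum>\<alpha> | mdeg \<alpha> = m. norm (a \<alpha>)) * norm \<xi> ^ m"
  unfolding sum_distrib_right
proof (rule sum_norm_le)
  fix \<alpha> :: "'a \<Rightarrow> nat" assume "\<alpha> \<in> {\<alpha>. mdeg \<alpha> = m}"
  then show "norm (a \<alpha> * monomial \<alpha> \<xi>) \<le> norm (a \<alpha>) * norm \<xi> ^ m"
    using norm_monomial_le[of \<alpha> \<xi>] by (simp add: norm_mult mult_left_mono)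
qed

section \<open>Principal parts\<close>

lemma keys_principal_part: "Poly_Mapping.keys (principal_part m Q) \<subseteq> {\<alpha>. mdeg \<alpha> = m}"
  by (auto simp: in_keys_iff principal_part.rep_eq split: if_splits)

lemma meval_principal_part:
  "meval (principal_part m Q) \<xi> = (\<Sum>\<alpha> | mdeg \<alpha> = m. Poly_Mapping.lookup Q \<alpha> * monomial \<alpha> \<xi>)"
  by (subst meval_eq_sum[OF finite_mdeg_eq keys_principal_part])
    (auto simp: principal_part.rep_eq intro!: sum.cong)

lemma meval_principal_part_scaleR:
  "meval (principal_part m Q) (t *\<^sub>R \<xi>) = of_real t ^ m * meval (principal_part m Q) \<xi>"
  by (auto simp: meval_principal_part monomial_scaleR sum_distrib_left mult_ac intro!: sum.cong)

lemma meval_diff: "meval (Q - R) \<xi> = meval Q \<xi> - meval R \<xi>"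
proof -
  let ?A = "Poly_Mapping.keys Q \<union> Poly_Mapping.keys R"
  have "Poly_Mapping.keys (Q - R) \<subseteq> ?A" by (auto simp: in_keys_iff lookup_minus)
  then show ?thesis
    by (simp add: meval_eq_sum[of ?A] lookup_minus left_diff_distrib sum_subtractf)
qed

text \<open>Removing the principal part leaves only terms of degree below \<open>m\<close>, and each
  remaining coefficient is one of \<open>Q\<close>.\<close>

lemma norm_meval_minus_principal_part_le:
  assumes "Poly_Mapping.keys Q \<subseteq> {\<alpha>. mdeg \<alpha> \<le> m}" "norm \<xi> \<le> r" "1 \<le> r"
  shows "r * norm (meval Q \<xi> - meval (principal_part m Q) \<xi>) \<le> coeff_norm m Q * r ^ m"
proof -
  let ?R = "Q - principal_part m Q"
  have "Poly_Mapping.keys ?R \<subseteq> {\<alpha>. mdeg \<alpha> < m}"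
    using assms(1) by (force simp: in_keys_iff lookup_minus principal_part.rep_eq split: if_splits)
  from norm_meval_lower_order_le[OF this assms(2,3)]
  have "r * norm (meval Q \<xi> - meval (principal_part m Q) \<xi>) \<le> coeff_norm m ?R * r ^ m"
    by (simp add: meval_diff)
  also have "\<dots> \<le> coeff_norm m Q * r ^ m"
    using assms(3) by (intro mult_right_mono)
      (auto simp: coeff_norm_def lookup_minus principal_part.rep_eq intro!: sum_mono)
  finally show ?thesis .
qed

section \<open>Derivatives and bounds for \<open>poly_tilde\<close>\<close>

lemma keys_mderiv:
  assumes "\<beta> \<in> Poly_Mapping.keys (mderiv \<alpha> Q)" "Poly_Mapping.keys Q \<subseteq> {\<alpha>. mdeg \<alpha> \<le> m}"
  shows "mdeg \<alpha> + mdeg \<beta> \<le> m"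
proof -
  have "(\<lambda>i. \<alpha> i + \<beta> i) \<in> Poly_Mapping.keys Q"
    using assms(1) by (auto simp: in_keys_iff mderiv.rep_eq)
  then show ?thesis using assms(2) by (auto simp: mdeg_add[symmetric])
qed

lemma norm_mderiv_le_poly_tilde: "norm (meval (mderiv \<alpha> Q) \<xi>) \<le> poly_tilde Q \<xi>"
\<comment> \<open>\<open>Sum_any\<close> unfolds to a sum over the nonvanishing terms, so \<alpha>
  is one of its indices only when the derivative is nonzero at \<xi>.\<close>
proof (cases "meval (mderiv \<alpha> Q) \<xi> = 0")
  case False
  have "(norm (meval (mderiv \<alpha> Q) \<xi>))\<^sup>2 \<le> Sum_any (\<lambda>\<alpha>. (norm (meval (mderiv \<alpha> Q) \<xi>))\<^sup>2)"
    unfolding Sum_any.expand_set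
    by (rule member_le_sum) (use False finite_poly_tilde_support[of Q \<xi>] in auto)
  then show ?thesis unfolding poly_tilde_def by (rule real_le_rsqrt)
qed (simp add: poly_tilde_def Sum_any.expand_set sum_nonneg)

lemma poly_tilde_nonneg: "poly_tilde Q \<xi> \<ge> 0"
  by (simp add: poly_tilde_def Sum_any.expand_set sum_nonneg)

lemma norm_meval_le_poly_tilde: "norm (meval Q \<xi>) \<le> poly_tilde Q \<xi>"
  using norm_mderiv_le_poly_tilde[of "\<lambda>_. 0" Q \<xi>] by (simp add: mderiv_zero)

text \<open>Derivatives of order above \<open>m\<close> vanish, and the Euclidean norm of the
  remaining ones is at most the sum of their moduli.\<close>

lemma poly_tilde_le_sum:
  assumes "Poly_Mapping.keys Q \<subseteq> {\<alpha>. mdeg \<alpha> \<le> m}"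
  shows "poly_tilde Q \<xi> \<le> (\<Sum>\<alpha> | mdeg \<alpha> \<le> m. norm (meval (mderiv \<alpha> Q) \<xi>))"
proof -
  have "Sum_any (\<lambda>\<alpha>. (norm (meval (mderiv \<alpha> Q) \<xi>))\<^sup>2)
      = (\<Sum>\<alpha> | mdeg \<alpha> \<le> m. (norm (meval (mderiv \<alpha> Q) \<xi>))\<^sup>2)"
  proof (rule Sum_any.expand_superset[OF finite_mdeg_le], safe)
    fix \<alpha> assume "(norm (meval (mderiv \<alpha> Q) \<xi>))\<^sup>2 \<noteq> 0"
    then have "Poly_Mapping.keys (mderiv \<alpha> Q) \<noteq> {}" by (auto simp: meval_def)
    then show "mdeg \<alpha> \<le> m" using keys_mderiv[OF _ assms, of _ \<alpha>] by fastforce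
  qed
  then show ?thesis
    using L2_set_le_sum[of "{\<alpha>. mdeg \<alpha> \<le> m}" "\<lambda>\<alpha>. norm (meval (mderiv \<alpha> Q) \<xi>)"]
    by (simp add: poly_tilde_def L2_set_def)
qed

lemma poly_tilde_upper:
  assumes "Poly_Mapping.keys Q \<subseteq> {\<alpha>. mdeg \<alpha> \<le> m}"
  shows "poly_tilde Q \<xi> \<le> (\<Sum>\<alpha> | mdeg \<alpha> \<le> m. coeff_norm m (mderiv \<alpha> Q)) * (1 + norm \<xi>) ^ m"
proof -
  have "norm (meval (mderiv \<alpha> Q) \<xi>) \<le> coeff_norm m (mderiv \<alpha> Q) * (1 + norm \<xi>) ^ m" for \<alpha>
    by (rule norm_meval_le) (use keys_mderiv[OF _ assms, of _ \<alpha>] in fastforce)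
  then have "(\<Sum>\<alpha> | mdeg \<alpha> \<le> m. norm (meval (mderiv \<alpha> Q) \<xi>))
      \<le> (\<Sum>\<alpha> | mdeg \<alpha> \<le> m. coeff_norm m (mderiv \<alpha> Q) * (1 + norm \<xi>) ^ m)"
    by (intro sum_mono)
  with poly_tilde_le_sum[OF assms, of \<xi>] show ?thesis by (simp add: sum_distrib_right)
qed

text \<open>The zero multi-index contributes \<open>norm (meval Q \<xi>)\<close>. All other
  derivatives have degree below \<open>m\<close>, which gains one power of \<open>r\<close>.\<close>

lemma poly_tilde_minus_norm_meval_le:
  assumes "Poly_Mapping.keys Q \<subseteq> {\<alpha>. mdeg \<alpha> \<le> m}" "norm \<xi> \<le> r" "1 \<le> r"
  shows "r * (poly_tilde Q \<xi> - norm (meval Q \<xi>))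
    \<le> (\<Sum>\<alpha> | mdeg \<alpha> \<le> m. coeff_norm m (mderiv \<alpha> Q)) * r ^ m"
proof -
  let ?A = "{\<alpha> :: 'a \<Rightarrow> nat. mdeg \<alpha> \<le> m}" and ?z = "(\<lambda>_. 0) :: 'a \<Rightarrow> nat"
  have z: "?z \<in> ?A" by (simp add: mdeg_def)
  have "poly_tilde Q \<xi> - norm (meval Q \<xi>) \<le> (\<Sum>\<alpha>\<in>?A - {?z}. norm (meval (mderiv \<alpha> Q) \<xi>))"
    using poly_tilde_le_sum[OF assms(1), of \<xi>] sum.remove[OF finite_mdeg_le z,
        of "\<lambda>\<alpha>. norm (meval (mderiv \<alpha> Q) \<xi>)"]
    by (simp add: mderiv_zero)
  then have "r * (poly_tilde Q \<xi> - norm (meval Q \<xi>))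
      \<le> (\<Sum>\<alpha>\<in>?A - {?z}. r * norm (meval (mderiv \<alpha> Q) \<xi>))"
    using assms(3) by (simp add: mult_left_mono flip: sum_distrib_left)
  also have "\<dots> \<le> (\<Sum>\<alpha>\<in>?A - {?z}. coeff_norm m (mderiv \<alpha> Q) * r ^ m)"
  proof (intro sum_mono norm_meval_lower_order_le assms(2,3) subsetI)
    fix \<alpha> \<beta> assume "\<alpha> \<in> ?A - {?z}" "\<beta> \<in> Poly_Mapping.keys (mderiv \<alpha> Q)"
    then show "\<beta> \<in> {\<beta>. mdeg \<beta> < m}"
      using keys_mderiv[OF _ assms(1), of \<beta> \<alpha>] mdeg_eq_0_iff[of \<alpha>] by fastforce
  qed
  also have "\<dots> \<le> (\<Sum>\<alpha>\<in>?A. coeff_norm m (mderiv \<alpha> Q) * r ^ m)"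
    using assms(3) by (intro sum_mono2 finite_mdeg_le) (auto simp: coeff_norm_nonneg)
  finally show ?thesis by (simp add: sum_distrib_right)
qed

text \<open>A derivative of order exactly \<open>m\<close> is constant, equal to \<alpha>! times the
  coefficient at \<alpha>, and \<alpha>! is at least 1.\<close>

lemma lookup_le_poly_tilde:
  assumes "Poly_Mapping.keys Q \<subseteq> {\<alpha>. mdeg \<alpha> \<le> m}" "mdeg \<alpha> = m"
  shows "norm (Poly_Mapping.lookup Q \<alpha>) \<le> poly_tilde Q \<xi>"
proof -
  let ?z = "\<lambda>_::'a. 0::nat"
  have "Poly_Mapping.keys (mderiv \<alpha> Q) \<subseteq> {?z}"
    using keys_mderiv[OF _ assms(1), of _ \<alpha>] assms(2) mdeg_eq_0_iff by fastforce
  then have "meval (mderiv \<alpha> Q) \<xi> = (\<Prod>i\<in>UNIV. fact (\<alpha> i)) * Poly_Mapping.lookup Q \<alpha>"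
    by (subst meval_eq_sum[of "{?z}"]) (auto simp: mderiv.rep_eq monomial_def)
  then have "norm (meval (mderiv \<alpha> Q) \<xi>) = (\<Prod>i\<in>UNIV. fact (\<alpha> i)) * norm (Poly_Mapping.lookup Q \<alpha>)"
    by (simp add: norm_mult prod_norm[symmetric])
  moreover have "(1::real) \<le> (\<Prod>i\<in>UNIV. fact (\<alpha> i))" by (intro prod_ge_1) auto
  ultimately have "norm (Poly_Mapping.lookup Q \<alpha>) \<le> norm (meval (mderiv \<alpha> Q) \<xi>)"
    using mult_right_mono[of 1 "\<Prod>i\<in>UNIV. fact (\<alpha> i)" "norm (Poly_Mapping.lookup Q \<alpha>)"] by simp
  with norm_mderiv_le_poly_tilde[of \<alpha> Q \<xi>] show ?thesis by linarith
qed

section \<open>Comparison for fixed parameter\<close>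

text \<open>Only the top-order terms survive when the estimate is taken at \<open>t *\<^sub>R \<xi>\<close> as \<open>t\<close> grows.\<close>

lemma principal_part_le_of_poly_tilde_le:
  fixes P Q :: "('n::finite, complex) mpoly"
  assumes P: "Poly_Mapping.keys P \<subseteq> {\<alpha>. mdeg \<alpha> \<le> m}"
    and Q: "Poly_Mapping.keys Q \<subseteq> {\<alpha>. mdeg \<alpha> \<le> m}"
    and le: "\<And>\<xi>. poly_tilde Q \<xi> \<le> l * poly_tilde P \<xi>"
  shows "norm (meval (principal_part m Q) \<xi>) \<le> \<bar>l\<bar> * norm (meval (principal_part m P) \<xi>)"
    (is "?X \<le> \<bar>l\<bar> * ?Y")
proof (rule ccontr)
  \<comment> \<open>With this choice \<open>t * s\<close> is at least 1 and at least the norm of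
    \<open>t *\<^sub>R \<xi>\<close> for every \<open>t \<ge> 1\<close>, as the lower order bounds
    require.\<close>
  define s where "s = 1 + norm \<xi>"
  define T where "T = (\<Sum>\<alpha> | mdeg \<alpha> \<le> m. coeff_norm m (mderiv \<alpha> P))"
  \<comment> \<open>\<open>K\<close> gathers three errors: the lower order terms of
    \<open>Q\<close>, and, multiplied by the modulus of \<open>l\<close>, the lower order terms and
    the proper derivatives of \<open>P\<close>.\<close>
  define K where "K = \<bar>l\<bar> * (coeff_norm m P + T) + coeff_norm m Q"
  have s: "s \<ge> 1" by (simp add: s_def)
  \<comment> \<open>The errors have one power of \<open>t\<close> less than the principal parts.
    After cancelling \<open>t ^ m\<close> the excess is multiplied by \<open>t\<close>, whereas the
    right side is independent of \<open>t\<close>.\<close>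
  have bound: "t * (s * (?X - \<bar>l\<bar> * ?Y)) \<le> K * s ^ m" if t: "t \<ge> 1" for t
  proof -
    let ?\<eta> = "t *\<^sub>R \<xi>" and ?r = "t * s"
    have r: "norm ?\<eta> \<le> ?r" "1 \<le> ?r"
      using t s mult_mono[of 1 t 1 s] by (auto simp: s_def)
    have hom: "norm (meval (principal_part m R) ?\<eta>) = t ^ m * norm (meval (principal_part m R) \<xi>)"
      for R :: "('n, complex) mpoly"
      using t by (simp add: meval_principal_part_scaleR norm_mult norm_power)
    have "norm (meval (principal_part m Q) ?\<eta>) \<le> norm (meval Q ?\<eta>)
        + norm (meval Q ?\<eta> - meval (principal_part m Q) ?\<eta>)"
      by norm
    then have "?r * norm (meval (principal_part m Q) ?\<eta>) \<le> ?r * (norm (meval Q ?\<eta>)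
        + norm (meval Q ?\<eta> - meval (principal_part m Q) ?\<eta>))"
      using r by (intro mult_left_mono) auto
    then have 1: "?r * (t ^ m * ?X) \<le> ?r * norm (meval Q ?\<eta>) + coeff_norm m Q * ?r ^ m"
      using norm_meval_minus_principal_part_le[OF Q r] unfolding hom by (simp add: distrib_left)
    have "norm (meval Q ?\<eta>) \<le> \<bar>l\<bar> * poly_tilde P ?\<eta>"
      using norm_meval_le_poly_tilde[of Q ?\<eta>] le[of ?\<eta>]
        mult_right_mono[OF abs_ge_self[of l] poly_tilde_nonneg[of P ?\<eta>]] by linarith
    then have 2: "?r * norm (meval Q ?\<eta>) \<le> \<bar>l\<bar> * (?r * poly_tilde P ?\<eta>)"
      using mult_left_mono[of "norm (meval Q ?\<eta>)" "\<bar>l\<bar> * poly_tilde P ?\<eta>" ?r] r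
      by (simp add: mult.left_commute)
    have 3: "?r * poly_tilde P ?\<eta> \<le> ?r * norm (meval P ?\<eta>) + T * ?r ^ m"
      using poly_tilde_minus_norm_meval_le[OF P r] by (simp add: T_def right_diff_distrib)
    have "norm (meval P ?\<eta>) \<le> norm (meval (principal_part m P) ?\<eta>)
        + norm (meval P ?\<eta> - meval (principal_part m P) ?\<eta>)"
      by norm
    then have "?r * norm (meval P ?\<eta>) \<le> ?r * (norm (meval (principal_part m P) ?\<eta>)
        + norm (meval P ?\<eta> - meval (principal_part m P) ?\<eta>))"
      using r by (intro mult_left_mono) auto
    then have 4: "?r * norm (meval P ?\<eta>) \<le> ?r * (t ^ m * ?Y) + coeff_norm m P * ?r ^ m"
      using norm_meval_minus_principal_part_le[OF P r] unfolding hom by (simp add: distrib_left)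
    have "?r * poly_tilde P ?\<eta> \<le> ?r * (t ^ m * ?Y) + (coeff_norm m P + T) * ?r ^ m"
      using 3 4 by (simp add: distrib_right)
    then have "\<bar>l\<bar> * (?r * poly_tilde P ?\<eta>)
        \<le> \<bar>l\<bar> * (?r * (t ^ m * ?Y) + (coeff_norm m P + T) * ?r ^ m)"
      by (intro mult_left_mono) auto
    with 1 2 have "?r * (t ^ m * ?X)
        \<le> \<bar>l\<bar> * (?r * (t ^ m * ?Y) + (coeff_norm m P + T) * ?r ^ m) + coeff_norm m Q * ?r ^ m"
      by linarith
    then have "t ^ m * (t * (s * (?X - \<bar>l\<bar> * ?Y))) \<le> t ^ m * (K * s ^ m)"
      by (simp add: K_def algebra_simps power_mult_distrib)
    then show ?thesis using t by (simp add: mult_le_cancel_left)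
  qed
  assume "\<not> ?X \<le> \<bar>l\<bar> * ?Y"
  then have d: "s * (?X - \<bar>l\<bar> * ?Y) > 0" using s by auto
  \<comment> \<open>At this \<open>t\<close> the linear growth already exceeds the constant bound by
    1.\<close>
  define t where "t = max 1 ((K * s ^ m + 1) / (s * (?X - \<bar>l\<bar> * ?Y)))"
  have "K * s ^ m + 1 \<le> t * (s * (?X - \<bar>l\<bar> * ?Y))"
    using d by (simp add: t_def pos_divide_le_eq[symmetric])
  with bound[of t] show False by (simp add: t_def)
qed

section \<open>Elliptic polynomials at a fixed parameter\<close>

lemma poly_tilde_lower_elliptic_large:
  fixes P :: "('n::finite, complex) mpoly"
  assumes P: "Poly_Mapping.keys P \<subseteq> {\<alpha>. mdeg \<alpha> \<le> m}" and d: "d > 0"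
    and ell: "d * norm \<xi> ^ m \<le> norm (meval (principal_part m P) \<xi>)"
    and large: "1 + 2 * coeff_norm m P * inverse d \<le> norm \<xi>"
  shows "d * norm \<xi> ^ m \<le> 2 * poly_tilde P \<xi>"
proof -
  let ?r = "norm \<xi>" and ?M = "coeff_norm m P"
  have "0 \<le> ?M * inverse d" using d coeff_norm_nonneg[of m P] by simp
  then have r: "?r \<ge> 1" "2 * ?M * inverse d \<le> ?r" using large by linarith+
  \<comment> \<open>Hence the lower order terms use up at most half of
    \<open>d * norm \<xi> ^ m\<close>; the factor 2 in the conclusion pays for this half.\<close>
  then have M: "2 * ?M \<le> d * ?r" using d by (simp add: field_simps)
  have "norm (meval (principal_part m P) \<xi>) \<le> norm (meval P \<xi>)
      + norm (meval P \<xi> - meval (principal_part m P) \<xi>)"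
    by norm
  then have "d * ?r ^ m \<le> poly_tilde P \<xi> + norm (meval P \<xi> - meval (principal_part m P) \<xi>)"
    using ell norm_meval_le_poly_tilde[of P \<xi>] by linarith
  then have "?r * (d * ?r ^ m)
      \<le> ?r * (poly_tilde P \<xi> + norm (meval P \<xi> - meval (principal_part m P) \<xi>))"
    by (rule mult_left_mono) auto
  then have "?r * (d * ?r ^ m) \<le> ?r * poly_tilde P \<xi> + ?M * ?r ^ m"
    using norm_meval_minus_principal_part_le[OF P order_refl r(1)] by (simp add: distrib_left)
  moreover have "2 * ?M * ?r ^ m \<le> d * ?r * ?r ^ m"
    using M by (rule mult_right_mono) auto
  ultimately have "?r * (d * ?r ^ m) \<le> ?r * (2 * poly_tilde P \<xi>)" by (simp add: algebra_simps)
  then show ?thesis using r(1) by (auto simp: mult_le_cancel_left)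
qed

text \<open>The top-order derivatives are constants, so they bound \<open>poly_tilde P\<close> from below everywhere.\<close>

lemma poly_tilde_lower_elliptic:
  fixes P :: "('n::finite, complex) mpoly"
  assumes P: "Poly_Mapping.keys P \<subseteq> {\<alpha>. mdeg \<alpha> \<le> m}"
    and ell: "\<And>\<xi>. d * norm \<xi> ^ m \<le> norm (meval (principal_part m P) \<xi>)"
  shows "d \<le> card {\<alpha> :: 'n \<Rightarrow> nat. mdeg \<alpha> = m} * poly_tilde P \<xi>"
proof -
  \<comment> \<open>Any unit vector serves: ellipticity there forces the moduli of the top-order
    coefficients to add up to at least \<open>d\<close>.\<close>
  let ?e = "axis undefined 1 :: real ^ 'n"
  have "d \<le> norm (meval (principal_part m P) ?e)" using ell[of ?e] by simp
  also have "\<dots> \<le> (\<Sum>\<alpha> | mdeg \<alpha> = m. norm (Poly_Mapping.lookup P \<alpha>))"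
    using norm_homogeneous_sum_le[where a = "Poly_Mapping.lookup P" and m = m and \<xi> = ?e]
    by (simp add: meval_principal_part)
  also have "\<dots> \<le> (\<Sum>\<alpha> \<in> {\<alpha> :: 'n \<Rightarrow> nat. mdeg \<alpha> = m}. poly_tilde P \<xi>)"
    by (intro sum_mono lookup_le_poly_tilde[OF P]) auto
  finally show ?thesis by simp
qed

text \<open>The comparison factor is an explicit product in the coefficients and
  \<open>inverse d\<close>, so that along a net its moderateness can be read off factor by
  factor.\<close>

lemma poly_tilde_le_of_elliptic:
  fixes P Q :: "('n::finite, complex) mpoly"
  assumes P: "Poly_Mapping.keys P \<subseteq> {\<alpha>. mdeg \<alpha> \<le> m}"
    and Q: "Poly_Mapping.keys Q \<subseteq> {\<alpha>. mdeg \<alpha> \<le> m}"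
    and d: "d > 0" and ell: "\<And>\<xi>. d * norm \<xi> ^ m \<le> norm (meval (principal_part m P) \<xi>)"
  shows "poly_tilde Q \<xi> \<le> (\<Sum>\<alpha> | mdeg \<alpha> \<le> m. coeff_norm m (mderiv \<alpha> Q))
      * (2 + 2 * coeff_norm m P * inverse d) ^ m
      * (real (card {\<alpha> :: 'n \<Rightarrow> nat. mdeg \<alpha> = m}) + 2) * inverse d * poly_tilde P \<xi>"
    (is "_ \<le> ?T * ?R ^ m * (?B + 2) * inverse d * _")
proof -
  have T: "?T \<ge> 0" by (simp add: coeff_norm_nonneg sum_nonneg)
  have R: "?R \<ge> 2" using d coeff_norm_nonneg[of m P] by simp
  have up: "poly_tilde Q \<xi> \<le> ?T * (1 + norm \<xi>) ^ m" by (rule poly_tilde_upper[OF Q])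
  have tP: "poly_tilde P \<xi> \<ge> 0" by (rule poly_tilde_nonneg)
  \<comment> \<open>\<open>?R\<close> is the critical radius plus 1, so it bounds
    \<open>1 + norm \<xi>\<close> inside the ball; outside, \<open>?R \<ge> 2\<close> gives
    \<open>1 + norm \<xi> \<le> ?R * norm \<xi>\<close>. The factor \<open>?B + 2\<close> dominates
    the constants of both cases.\<close>
  have "(1 + norm \<xi>) ^ m * d \<le> ?R ^ m * (?B + 2) * poly_tilde P \<xi>"
  proof (cases "1 + 2 * coeff_norm m P * inverse d \<le> norm \<xi>")
    case True
    have r: "norm \<xi> \<ge> 1" using True R by linarith
    have "(1 + norm \<xi>) ^ m \<le> (?R * norm \<xi>) ^ m"
    proof (rule power_mono)
      have "1 + norm \<xi> \<le> 2 * norm \<xi>" using r by simp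
      also have "\<dots> \<le> ?R * norm \<xi>" using R by (intro mult_right_mono) auto
      finally show "1 + norm \<xi> \<le> ?R * norm \<xi>" .
    qed auto
    then have "(1 + norm \<xi>) ^ m * d \<le> (?R * norm \<xi>) ^ m * d"
      using d by (intro mult_right_mono) auto
    also have "\<dots> = ?R ^ m * (d * norm \<xi> ^ m)" by (simp add: power_mult_distrib)
    also have "\<dots> \<le> ?R ^ m * (2 * poly_tilde P \<xi>)"
      using poly_tilde_lower_elliptic_large[OF P d ell True] R by (intro mult_left_mono) auto
    also have "\<dots> \<le> ?R ^ m * ((?B + 2) * poly_tilde P \<xi>)"
      using R tP by (intro mult_left_mono mult_right_mono) auto
    finally show ?thesis by (simp add: mult_ac)
  next
    case False
    then have "(1 + norm \<xi>) ^ m \<le> ?R ^ m" by (intro power_mono) auto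
    then have "(1 + norm \<xi>) ^ m * d \<le> ?R ^ m * (?B * poly_tilde P \<xi>)"
      using poly_tilde_lower_elliptic[OF P ell, of \<xi>] d R by (intro mult_mono) auto
    also have "\<dots> \<le> ?R ^ m * ((?B + 2) * poly_tilde P \<xi>)"
      using R tP by (intro mult_left_mono mult_right_mono) auto
    finally show ?thesis by (simp add: mult_ac)
  qed
  then have "(1 + norm \<xi>) ^ m \<le> ?R ^ m * (?B + 2) * poly_tilde P \<xi> * inverse d"
    using d by (simp add: pos_le_divide_eq[symmetric] divide_inverse)
  then have "?T * (1 + norm \<xi>) ^ m \<le> ?T * (?R ^ m * (?B + 2) * poly_tilde P \<xi> * inverse d)"
    using T by (rule mult_left_mono)
  with up show ?thesis by (simp add: mult_ac)
qed


section \<open>The equivalence\<close>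

lemma poly_net_of_coeffs:
  fixes c :: "('n::finite \<Rightarrow> nat) \<Rightarrow> real \<Rightarrow> complex"
  assumes "finite A"
  obtains Pe where
    "\<And>\<epsilon> \<alpha>. Poly_Mapping.lookup (Pe \<epsilon>) \<alpha> = (if \<alpha> \<in> A then c \<alpha> \<epsilon> else 0)"
proof
  fix \<epsilon> \<alpha>
  have "finite {\<alpha>. (if \<alpha> \<in> A then c \<alpha> \<epsilon> else 0) \<noteq> 0}"
    by (rule finite_subset[OF _ assms]) auto
  then show "Poly_Mapping.lookup ((\<lambda>\<epsilon>. Abs_poly_mapping (\<lambda>\<alpha>. if \<alpha> \<in> A then c \<alpha> \<epsilon> else 0)) \<epsilon>) \<alpha>
      = (if \<alpha> \<in> A then c \<alpha> \<epsilon> else 0)"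
    by simp
qed

lemma moderate_coeff_norm:
  assumes "\<And>\<alpha>. moderate (\<lambda>\<epsilon>. Poly_Mapping.lookup (Pe \<epsilon>) \<alpha>)"
  shows "moderate (\<lambda>\<epsilon>. coeff_norm m (Pe \<epsilon>))"
  unfolding coeff_norm_def by (intro moderate_sum) (simp add: moderate_iff_norm assms)

lemma moderate_lookup_mderiv:
  assumes "\<And>\<alpha>. moderate (\<lambda>\<epsilon>. Poly_Mapping.lookup (Pe \<epsilon>) \<alpha>)"
  shows "moderate (\<lambda>\<epsilon>. Poly_Mapping.lookup (mderiv \<alpha> (Pe \<epsilon>)) \<beta>)"
  unfolding mderiv.rep_eq by (intro moderate_mult assms) simp

lemma stronger_of_G_elliptic:
  fixes P Q :: "('n::finite, gcomplex) mpoly"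
  assumes "G_elliptic m P" "k \<le> m"
  shows "stronger m P k Q"
proof -
  obtain Pme c a where Pme: "poly_represents {\<alpha>. mdeg \<alpha> = m} Pme (principal_part m P)"
    and c: "c > 0"
    and ell: "\<And>\<epsilon> \<xi>. \<epsilon> \<in> {0<..1} \<Longrightarrow> norm (meval (Pme \<epsilon>) \<xi>) \<ge> c * \<epsilon> powr a * norm \<xi> ^ m"
    using assms(1) unfolding G_elliptic_def by blast
  \<comment> \<open>Moderateness is measured by natural exponents. As \<open>a \<le> N\<close> and
    \<epsilon> is at most 1, \<open>\<epsilon> powr a\<close> is at least
    \<open>\<epsilon> ^ N\<close>.\<close>
  define N where "N = nat \<lceil>a\<rceil>"
  obtain r where r: "\<And>x. represents (r x) x" using represents_exists by metis
  \<comment> \<open>Top-order coefficients come from the elliptic representative, so that the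
    principal part of \<open>Pe \<epsilon>\<close> is exactly \<open>Pme \<epsilon>\<close>; the
    lower ones are arbitrary representatives.\<close>
  define pc where "pc \<alpha> = (if mdeg \<alpha> = m then (\<lambda>\<epsilon>. Poly_Mapping.lookup (Pme \<epsilon>) \<alpha>)
    else r (Poly_Mapping.lookup P \<alpha>))" for \<alpha>
  obtain Pe where Pe: "\<And>\<epsilon> \<alpha>. Poly_Mapping.lookup (Pe \<epsilon>) \<alpha> = (if \<alpha> \<in> {\<alpha>. mdeg \<alpha> \<le> m} then pc \<alpha> \<epsilon> else 0)"
    using poly_net_of_coeffs[OF finite_mdeg_le, of m pc] by blast
  obtain Qe :: "real \<Rightarrow> ('n, complex) mpoly" where Qe: "\<And>\<epsilon> \<alpha>. Poly_Mapping.lookup (Qe \<epsilon>) \<alpha>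
      = (if \<alpha> \<in> {\<alpha>. mdeg \<alpha> \<le> k} then r (Poly_Mapping.lookup Q \<alpha>) \<epsilon> else 0)"
    using poly_net_of_coeffs[OF finite_mdeg_le, of k "\<lambda>\<alpha>. r (Poly_Mapping.lookup Q \<alpha>)"] by blast
  have pc: "represents (pc \<alpha>) (Poly_Mapping.lookup P \<alpha>)" for \<alpha>
    using Pme r by (auto simp: pc_def poly_represents_def principal_part.rep_eq)
  have keysP: "Poly_Mapping.keys (Pe \<epsilon>) \<subseteq> {\<alpha>. mdeg \<alpha> \<le> m}" for \<epsilon>
    by (auto simp: in_keys_iff Pe split: if_splits)
  have keysQ: "Poly_Mapping.keys (Qe \<epsilon>) \<subseteq> {\<alpha>. mdeg \<alpha> \<le> k}" for \<epsilon>
    by (auto simp: in_keys_iff Qe split: if_splits)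
  have modP: "moderate (\<lambda>\<epsilon>. Poly_Mapping.lookup (Pe \<epsilon>) \<alpha>)" for \<alpha>
    using pc[of \<alpha>] by (cases "mdeg \<alpha> \<le> m") (auto simp: Pe represents_def)
  have modQ: "moderate (\<lambda>\<epsilon>. Poly_Mapping.lookup (Qe \<epsilon>) \<alpha>)" for \<alpha>
    using r[of "Poly_Mapping.lookup Q \<alpha>"] by (cases "mdeg \<alpha> \<le> k") (auto simp: Qe represents_def)
  have repP: "poly_represents {\<alpha>. mdeg \<alpha> \<le> m} Pe P"
    using keysP pc by (auto simp: poly_represents_def Pe)
  have repQ: "poly_represents {\<alpha>. mdeg \<alpha> \<le> k} Qe Q"
    using keysQ r by (auto simp: poly_represents_def Qe)
  \<comment> \<open>This is \<open>inverse d\<close> for the ellipticity constant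
    \<open>d = c * \<epsilon> ^ N\<close>, and \<open>l\<close> is the factor of
    \<open>poly_tilde_le_of_elliptic\<close> for that \<open>d\<close>.\<close>
  define i where "i \<epsilon> = inverse c * inverse (\<epsilon> ^ N)" for \<epsilon> :: real
  define l where "l \<epsilon> = (\<Sum>\<alpha> | mdeg \<alpha> \<le> m. coeff_norm m (mderiv \<alpha> (Qe \<epsilon>)))
      * (2 + 2 * coeff_norm m (Pe \<epsilon>) * i \<epsilon>) ^ m
      * (real (card {\<alpha> :: 'n \<Rightarrow> nat. mdeg \<alpha> = m}) + 2) * i \<epsilon>" for \<epsilon>
  have "moderate i"
    unfolding i_def by (intro moderate_mult moderate_inverse_power moderate_of_const)
  then have "moderate l"
    unfolding l_def
    by (intro moderate_mult moderate_power moderate_add moderate_sum moderate_of_const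
        moderate_coeff_norm moderate_lookup_mderiv modP modQ)
  moreover have "poly_tilde (Qe \<epsilon>) \<xi> \<le> l \<epsilon> * poly_tilde (Pe \<epsilon>) \<xi>" if \<epsilon>: "\<epsilon> \<in> {0<..1}" for \<epsilon> \<xi>
  proof -
    have "a \<le> real N" unfolding N_def by linarith
    then have "\<epsilon> ^ N \<le> \<epsilon> powr a"
      using \<epsilon> powr_mono'[of a "real N" \<epsilon>] by (simp add: powr_realpow)
    then have "c * \<epsilon> ^ N * norm \<eta> ^ m \<le> norm (meval (Pme \<epsilon>) \<eta>)" for \<eta>
      using c by (intro order_trans[OF _ ell[OF \<epsilon>]] mult_right_mono mult_left_mono) auto
    moreover have keys: "Poly_Mapping.keys (Pme \<epsilon>) \<subseteq> {\<alpha>. mdeg \<alpha> = m}"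
      using Pme \<epsilon> by (simp add: poly_represents_def)
    moreover have "meval (principal_part m (Pe \<epsilon>)) \<eta> = meval (Pme \<epsilon>) \<eta>" for \<eta>
      unfolding meval_principal_part meval_eq_sum[OF finite_mdeg_eq keys]
      by (rule sum.cong) (auto simp: Pe pc_def)
    ultimately have "c * \<epsilon> ^ N * norm \<eta> ^ m \<le> norm (meval (principal_part m (Pe \<epsilon>)) \<eta>)" for \<eta>
      by simp
    moreover have "Poly_Mapping.keys (Qe \<epsilon>) \<subseteq> {\<alpha>. mdeg \<alpha> \<le> m}"
      using keysQ[of \<epsilon>] assms(2) by auto
    moreover have "c * \<epsilon> ^ N > 0" "inverse (c * \<epsilon> ^ N) = i \<epsilon>" using c \<epsilon> by (auto simp: i_def)
    ultimately show ?thesis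
      using poly_tilde_le_of_elliptic[where P = "Pe \<epsilon>" and Q = "Qe \<epsilon>" and d = "c * \<epsilon> ^ N",
          OF keysP, of \<xi>] by (simp add: l_def)
  qed
  ultimately show ?thesis unfolding stronger_def using repP repQ by blast
qed

section \<open>From strength over pure powers to ellipticity\<close>

lemma norm_le_card_times_component: "\<exists>j. norm \<xi> \<le> real CARD('n) * \<bar>\<xi> $ j\<bar>"
  for \<xi> :: "real ^ 'n"
\<comment> \<open>If every component were too small, the sum of their moduli would fall below the
  Euclidean norm.\<close>
proof (rule ccontr)
  assume "\<nexists>j. norm \<xi> \<le> real CARD('n) * \<bar>\<xi> $ j\<bar>"
  then have "(\<Sum>j\<in>(UNIV :: 'n set). real CARD('n) * \<bar>\<xi> $ j\<bar>) < (\<Sum>j\<in>(UNIV :: 'n set). norm \<xi>)"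
    by (intro sum_strict_mono) (auto simp: not_le)
  then have "real CARD('n) * (\<Sum>j\<in>UNIV. \<bar>\<xi> $ j\<bar>) < real CARD('n) * norm \<xi>"
    by (simp add: sum_distrib_left)
  with norm_le_l1_cart[of \<xi>] show False by simp
qed

lemma G_elliptic_of_stronger:
  fixes P :: "('n::finite, gcomplex) mpoly"
  assumes "\<And>j. stronger m P m (Poly_Mapping.single ((\<lambda>_. 0)(j := m)) 1)"
  shows "G_elliptic m P"
proof -
  let ?H = "{\<alpha> :: 'n \<Rightarrow> nat. mdeg \<alpha> = m}"
  define \<delta> where "\<delta> j = (\<lambda>_. 0)(j := m)" for j :: 'n
  have \<delta>: "\<delta> j \<in> ?H" for j by (simp add: \<delta>_def mdeg_def)
  define n where "n = real CARD('n)"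
  have n: "n > 0" by (simp add: n_def)
  have "\<forall>j. \<exists>Pe Qe. \<exists>l :: real \<Rightarrow> real.
        poly_represents {\<alpha>. mdeg \<alpha> \<le> m} Pe P \<and>
        poly_represents {\<alpha>. mdeg \<alpha> \<le> m} Qe (Poly_Mapping.single (\<delta> j) 1) \<and> moderate l \<and>
        (\<forall>\<epsilon>\<in>{0<..1}. \<forall>\<xi>. poly_tilde (Qe \<epsilon>) \<xi> \<le> l \<epsilon> * poly_tilde (Pe \<epsilon>) \<xi>)"
    using assms unfolding stronger_def \<delta>_def by blast
  then obtain Pe Qe and l :: "'n \<Rightarrow> real \<Rightarrow> real" where
    repP: "\<And>j. poly_represents {\<alpha>. mdeg \<alpha> \<le> m} (Pe j) P" and
    repQ: "\<And>j. poly_represents {\<alpha>. mdeg \<alpha> \<le> m} (Qe j) (Poly_Mapping.single (\<delta> j) 1)" and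
    modl: "\<And>j. moderate (l j)" and
    le: "\<And>j \<epsilon> \<xi>. \<epsilon> \<in> {0<..1} \<Longrightarrow> poly_tilde (Qe j \<epsilon>) \<xi> \<le> l j \<epsilon> * poly_tilde (Pe j \<epsilon>) \<xi>"
    by metis
  \<comment> \<open>The index type is inhabited; \<open>Pe j0\<close> becomes the common reference
    representative. \<open>p j\<close> measures how far the top-order coefficients of
    \<open>Pe j\<close> are from it, and \<open>q j\<close> how far those of \<open>Qe j\<close> are
    from the pure power.\<close>
  obtain j0 :: 'n where True by simp
  define p where "p j \<epsilon> = (\<Sum>\<alpha>\<in>?H. norm (Poly_Mapping.lookup (Pe j \<epsilon>) \<alpha>
    - Poly_Mapping.lookup (Pe j0 \<epsilon>) \<alpha>))" for j \<epsilon>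
  define q where "q j \<epsilon> = (\<Sum>\<alpha>\<in>?H. norm (of_bool (\<alpha> = \<delta> j) - Poly_Mapping.lookup (Qe j \<epsilon>) \<alpha>))"
    for j \<epsilon>
  have lookup_rep: "represents (\<lambda>\<epsilon>. Poly_Mapping.lookup (Pe j \<epsilon>) \<alpha>) (Poly_Mapping.lookup P \<alpha>)"
    "represents (\<lambda>\<epsilon>. Poly_Mapping.lookup (Qe j \<epsilon>) \<alpha>) (of_bool (\<alpha> = \<delta> j))" if "\<alpha> \<in> ?H" for j \<alpha>
  proof -
    have "Poly_Mapping.lookup (Poly_Mapping.single (\<delta> j) (1::gcomplex)) \<alpha> = of_bool (\<alpha> = \<delta> j)"
      by (auto simp: lookup_single when_def)
    then show "represents (\<lambda>\<epsilon>. Poly_Mapping.lookup (Pe j \<epsilon>) \<alpha>) (Poly_Mapping.lookup P \<alpha>)"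
      "represents (\<lambda>\<epsilon>. Poly_Mapping.lookup (Qe j \<epsilon>) \<alpha>) (of_bool (\<alpha> = \<delta> j))"
      using repP[of j] repQ[of j] that unfolding poly_represents_def by force+
  qed
  have "negligible_net (p j)" for j
    unfolding p_def
  proof (intro negligible_net_sum)
    fix \<alpha> assume "\<alpha> \<in> ?H"
    then show "negligible_net (\<lambda>\<epsilon>. norm (Poly_Mapping.lookup (Pe j \<epsilon>) \<alpha>
        - Poly_Mapping.lookup (Pe j0 \<epsilon>) \<alpha>))"
      using represents_iff[OF lookup_rep(1), of \<alpha> _ j] lookup_rep(1)[of \<alpha> j0]
      by (simp add: negligible_net_iff_norm)
  qed
  moreover have "negligible_net (q j)" for j
    unfolding q_def
  proof (intro negligible_net_sum)
    fix \<alpha> assume "\<alpha> \<in> ?H"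
    then show "negligible_net (\<lambda>\<epsilon>. norm (of_bool (\<alpha> = \<delta> j) - Poly_Mapping.lookup (Qe j \<epsilon>) \<alpha>))"
      using represents_iff[OF represents_of_bool] lookup_rep(2) by (simp add: negligible_net_iff_norm)
  qed
  moreover have modl': "moderate (\<lambda>\<epsilon>. \<bar>l j \<epsilon>\<bar>)" for j
    using modl[of j] moderate_iff_norm[of "l j"] by simp
  \<comment> \<open>A moderate factor keeps a negligible net negligible, so multiplying
    \<open>p j\<close> by \<open>l j\<close> does no harm. Summing over \<open>j\<close> makes the
    smallness uniform in \<open>j\<close>.\<close>
  ultimately have "negligible_net (\<lambda>\<epsilon>. \<Sum>j\<in>UNIV. q j \<epsilon> + \<bar>l j \<epsilon>\<bar> * p j \<epsilon>)"
    by (intro negligible_net_sum negligible_net_add negligible_net_mult)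
  from negligible_net_tendsto_0[OF this]
  have ev1: "eventually (\<lambda>\<epsilon>. (\<Sum>j\<in>UNIV. q j \<epsilon> + \<bar>l j \<epsilon>\<bar> * p j \<epsilon>) < 1 / (2 * n ^ m)) (at_right 0)"
    using n by (intro order_tendstoD) auto
  \<comment> \<open>The sum yields one constant \<open>C\<close> and one exponent \<open>N\<close>
    valid for all \<open>l j\<close>.\<close>
  have "moderate (\<lambda>\<epsilon>. \<Sum>j\<in>UNIV. \<bar>l j \<epsilon>\<bar>)"
    by (intro moderate_sum modl')
  then obtain N where "(\<lambda>\<epsilon>. norm (\<Sum>j\<in>UNIV. \<bar>l j \<epsilon>\<bar>)) \<in> O[at_right 0](\<lambda>\<epsilon>. inverse (\<epsilon> ^ N))"
    unfolding moderate_def by blast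
  then obtain C where C: "C > 0" and
    ev2: "eventually (\<lambda>\<epsilon>. norm (norm (\<Sum>j\<in>UNIV. \<bar>l j \<epsilon>\<bar>)) \<le> C * norm (inverse (\<epsilon> ^ N)))
      (at_right 0)"
    by (elim landau_o.bigE)
  obtain b where b: "b > 0" and
    small: "\<And>\<epsilon>. 0 < \<epsilon> \<Longrightarrow> \<epsilon> < b \<Longrightarrow> (\<Sum>j\<in>UNIV. q j \<epsilon> + \<bar>l j \<epsilon>\<bar> * p j \<epsilon>) < 1 / (2 * n ^ m)
      \<and> norm (norm (\<Sum>j\<in>UNIV. \<bar>l j \<epsilon>\<bar>)) \<le> C * norm (inverse (\<epsilon> ^ N))"
    using eventually_conj[OF ev1 ev2] unfolding eventually_at_right_field by blast
  \<comment> \<open>Halving \<open>b\<close> keeps \<open>\<epsilon>0\<close> strictly below it, so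
    the estimates hold at \<open>\<epsilon>0\<close> itself, where the net is frozen later.\<close>
  define \<epsilon>0 where "\<epsilon>0 = min (b / 2) 1"
  have \<epsilon>0: "0 < \<epsilon>0" "\<epsilon>0 \<le> 1" "\<epsilon>0 < b" using b by (auto simp: \<epsilon>0_def)
  define c where "c = 1 / (2 * n ^ m * C)"
  have c: "c > 0" using n C by (simp add: c_def)
  have est: "c * \<epsilon> ^ N * norm \<xi> ^ m \<le> norm (meval (principal_part m (Pe j0 \<epsilon>)) \<xi>)"
    if \<epsilon>: "0 < \<epsilon>" "\<epsilon> \<le> \<epsilon>0" for \<epsilon> \<xi>
  proof -
    \<comment> \<open>The index \<open>j\<close> depends on \<xi>, which is why \<open>Pe j\<close>
      has to be replaced by the fixed \<open>Pe j0\<close>.\<close>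
    obtain j where j: "norm \<xi> \<le> n * \<bar>\<xi> $ j\<bar>"
      using norm_le_card_times_component[of \<xi>] by (auto simp: n_def)
    have \<epsilon>1: "\<epsilon> \<in> {0<..1}" using \<epsilon> \<epsilon>0 by auto
    let ?X = "norm \<xi> ^ m" and ?P = "\<lambda>j. meval (principal_part m (Pe j \<epsilon>)) \<xi>"
    let ?Q = "meval (principal_part m (Qe j \<epsilon>)) \<xi>"
    \<comment> \<open>Writing the pure power as a homogeneous sum lets its difference from
      \<open>?Q\<close> be taken coefficientwise.\<close>
    have "monomial (\<delta> j) \<xi> = (\<Sum>\<alpha>\<in>?H. if \<alpha> = \<delta> j then monomial \<alpha> \<xi> else 0)"
      using \<delta>[of j] by (subst sum.delta[OF finite_mdeg_eq]) auto
    also have "\<dots> = (\<Sum>\<alpha>\<in>?H. of_bool (\<alpha> = \<delta> j) * monomial \<alpha> \<xi>)"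
      by (rule sum.cong) auto
    finally have "monomial (\<delta> j) \<xi> - ?Q
        = (\<Sum>\<alpha>\<in>?H. (of_bool (\<alpha> = \<delta> j) - Poly_Mapping.lookup (Qe j \<epsilon>) \<alpha>) * monomial \<alpha> \<xi>)"
      by (simp add: meval_principal_part left_diff_distrib sum_subtractf)
    then have "norm (monomial (\<delta> j) \<xi> - ?Q) \<le> q j \<epsilon> * ?X"
      unfolding q_def by (simp only: norm_homogeneous_sum_le)
    moreover have "norm (monomial (\<delta> j) \<xi>) = \<bar>\<xi> $ j\<bar> ^ m"
      by (simp add: \<delta>_def monomial_axis norm_power)
    ultimately have 1: "\<bar>\<xi> $ j\<bar> ^ m \<le> norm ?Q + q j \<epsilon> * ?X"
      using norm_triangle_sub[of "monomial (\<delta> j) \<xi>" ?Q] by linarith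
    have 2: "norm ?Q \<le> \<bar>l j \<epsilon>\<bar> * norm (?P j)"
      by (rule principal_part_le_of_poly_tilde_le)
        (use repP[of j] repQ[of j] \<epsilon>1 le[OF \<epsilon>1, of j] in \<open>auto simp: poly_represents_def\<close>)
    have "?P j - ?P j0 = (\<Sum>\<alpha>\<in>?H. (Poly_Mapping.lookup (Pe j \<epsilon>) \<alpha>
        - Poly_Mapping.lookup (Pe j0 \<epsilon>) \<alpha>) * monomial \<alpha> \<xi>)"
      by (simp add: meval_principal_part left_diff_distrib sum_subtractf)
    then have "norm (?P j - ?P j0) \<le> p j \<epsilon> * ?X"
      unfolding p_def by (simp only: norm_homogeneous_sum_le)
    then have "norm (?P j) \<le> norm (?P j0) + p j \<epsilon> * ?X"
      using norm_triangle_sub[of "?P j" "?P j0"] by linarith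
    then have "\<bar>l j \<epsilon>\<bar> * norm (?P j) \<le> \<bar>l j \<epsilon>\<bar> * (norm (?P j0) + p j \<epsilon> * ?X)"
      by (rule mult_left_mono) auto
    with 1 2 have 3: "\<bar>\<xi> $ j\<bar> ^ m \<le> (q j \<epsilon> + \<bar>l j \<epsilon>\<bar> * p j \<epsilon>) * ?X + \<bar>l j \<epsilon>\<bar> * norm (?P j0)"
      by (simp add: algebra_simps)
    have "q j \<epsilon> + \<bar>l j \<epsilon>\<bar> * p j \<epsilon> \<le> (\<Sum>j\<in>UNIV. q j \<epsilon> + \<bar>l j \<epsilon>\<bar> * p j \<epsilon>)"
      by (rule member_le_sum) (auto simp: p_def q_def sum_nonneg)
    then have "q j \<epsilon> + \<bar>l j \<epsilon>\<bar> * p j \<epsilon> \<le> 1 / (2 * n ^ m)"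
      using small[of \<epsilon>] \<epsilon> \<epsilon>0 by auto
    then have 4: "(q j \<epsilon> + \<bar>l j \<epsilon>\<bar> * p j \<epsilon>) * ?X \<le> 1 / (2 * n ^ m) * ?X"
      by (rule mult_right_mono) auto
    have "\<bar>l j \<epsilon>\<bar> \<le> (\<Sum>j\<in>UNIV. \<bar>l j \<epsilon>\<bar>)" by (rule member_le_sum) auto
    also have "\<dots> \<le> C * inverse (\<epsilon> ^ N)" using small[of \<epsilon>] \<epsilon> \<epsilon>0 by auto
    finally have 5: "\<bar>l j \<epsilon>\<bar> * norm (?P j0) \<le> C * inverse (\<epsilon> ^ N) * norm (?P j0)"
      by (rule mult_right_mono) auto
    have "?X \<le> n ^ m * \<bar>\<xi> $ j\<bar> ^ m"
      using power_mono[OF j, of m] by (simp add: power_mult_distrib)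
    also have "\<dots> \<le> n ^ m * (1 / (2 * n ^ m) * ?X + C * inverse (\<epsilon> ^ N) * norm (?P j0))"
      using 3 4 5 n by (intro mult_left_mono) auto
    \<comment> \<open>The threshold \<open>1 / (2 * n ^ m)\<close> was chosen so that the negligible
      errors amount to half of \<open>?X\<close> and can be absorbed on the left; \<open>c\<close>
      is the inverse of the remaining factor \<open>2 * n ^ m * C\<close>.\<close>
    also have "\<dots> = ?X / 2 + n ^ m * C * inverse (\<epsilon> ^ N) * norm (?P j0)"
      using n by (simp add: field_simps)
    finally have "?X \<le> 2 * n ^ m * C * inverse (\<epsilon> ^ N) * norm (?P j0)" by simp
    then show ?thesis using n C \<epsilon> by (simp add: c_def field_simps)
  qed
  \<comment> \<open>Freezing the parameter at \<open>\<epsilon>0\<close> extends the estimate to all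
    of \<open>(0,1]\<close> without changing the germ at \<open>0+\<close>, hence without changing
    the class.\<close>
  define Pme where "Pme \<epsilon> = principal_part m (Pe j0 (min \<epsilon> \<epsilon>0))" for \<epsilon>
  have "poly_represents ?H Pme (principal_part m P)"
    unfolding poly_represents_def
  proof (intro conjI ballI)
    fix \<alpha> assume \<alpha>: "\<alpha> \<in> ?H"
    have "eventually (\<lambda>\<epsilon>. Poly_Mapping.lookup (Pe j0 \<epsilon>) \<alpha> = Poly_Mapping.lookup (Pme \<epsilon>) \<alpha>)
        (at_right 0)"
      using eventually_at_right_real[OF \<epsilon>0(1)]
      by eventually_elim (use \<alpha> in \<open>auto simp: Pme_def principal_part.rep_eq min_def\<close>)
    with lookup_rep(1)[OF \<alpha>, of j0]
    show "represents (\<lambda>\<epsilon>. Poly_Mapping.lookup (Pme \<epsilon>) \<alpha>) (Poly_Mapping.lookup (principal_part m P) \<alpha>)"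
      using \<alpha> represents_cong by (simp add: principal_part.rep_eq)
  qed (simp add: Pme_def keys_principal_part)
  moreover have "norm (meval (Pme \<epsilon>) \<xi>) \<ge> (c * \<epsilon>0 ^ N) * \<epsilon> powr real N * norm \<xi> ^ m"
    if "\<epsilon> \<in> {0<..1}" for \<epsilon> \<xi>
  proof -
    \<comment> \<open>Both factors are at most 1, so the product lies below each. This trades the
      minimum for a multiple of \<epsilon>, and \<open>\<epsilon>0 ^ N\<close> goes into the
      constant.\<close>
    have "\<epsilon>0 * \<epsilon> \<le> min \<epsilon> \<epsilon>0"
      using that \<epsilon>0 mult_right_mono[of \<epsilon>0 1 \<epsilon>] mult_left_mono[of \<epsilon> 1 \<epsilon>0] by auto
    then have "(\<epsilon>0 * \<epsilon>) ^ N \<le> min \<epsilon> \<epsilon>0 ^ N" using that \<epsilon>0 by (intro power_mono) auto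
    then have "c * (\<epsilon>0 * \<epsilon>) ^ N * norm \<xi> ^ m \<le> c * min \<epsilon> \<epsilon>0 ^ N * norm \<xi> ^ m"
      using c by (intro mult_right_mono mult_left_mono) auto
    also have "\<dots> \<le> norm (meval (Pme \<epsilon>) \<xi>)"
      unfolding Pme_def using that \<epsilon>0 by (intro est) auto
    finally show ?thesis using that by (simp add: powr_realpow power_mult_distrib mult_ac)
  qed
  moreover have "c * \<epsilon>0 ^ N > 0" using c \<epsilon>0 by simp
  ultimately show ?thesis unfolding G_elliptic_def by blast
qed

theorem proposition1p9:
  fixes P :: "('n::finite, gcomplex) mpoly" and m :: nat
  assumes "has_order m P"
  shows "(\<forall>k\<le>m. \<forall>Q :: ('n, gcomplex) mpoly. has_order k Q \<longrightarrow> stronger m P k Q) \<longleftrightarrow> G_elliptic m P"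
proof
  assume *: "\<forall>k\<le>m. \<forall>Q :: ('n, gcomplex) mpoly. has_order k Q \<longrightarrow> stronger m P k Q"
  \<comment> \<open>Testing with \<open>k = m\<close> on the pure powers of the coordinates is
    enough.\<close>
  have "has_order m (Poly_Mapping.single ((\<lambda>_. 0)(j := m)) (1::gcomplex))" for j :: 'n
    by (auto simp: has_order_def mdeg_def)
  with * show "G_elliptic m P" by (intro G_elliptic_of_stronger) auto
qed (auto intro: stronger_of_G_elliptic)

end
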